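(* Let $p\ge 1$ and $q\ge 2$ be integers and $\nu\in(0,1]$ with $q>p+\nu$. There is a constant $c>0$ depending only on $p,q,\nu$ such that the following holds for all $H>0$, $\sigma>0$ and all positive integers $d,T$ with $\sqrt d-1\le T\le d$. For every $T$-step deterministic algorithm $\mathcal A$ on $\mathbb R^d$ with oracle access up to the $p$-th order, there exist a convex function $f:\mathbb R^d\to\mathbb R$ that is $p$-th order Hölder smooth with degree $\nu$ and modulus $H$, and the corresponding function $F(\mathbf x)=f(\mathbf x)+\frac{\sigma}{q}\|\mathbf x\|^q$, which is uniformly convex with degree $q$ and modulus $\sigma$, such that for every $\epsilon>0$: if the point $\mathbf x_T$ produced by $\mathcal A$ run on $F$ satisfies $F(\mathbf x_T)-F(\mathbf x^\ast)\le\epsilon$, where $\mathbf x^\ast$ is the minimizer of $F$, then $$T\ \ge\ c\left(\frac{H}{\sigma}\right)^{\frac{2}{3(p+\nu)-2}}\left(\frac{\sigma}{\epsilon}\right)^{\frac{2(q-p-\nu)}{q(3(p+\nu)-2)}}.$$ That is, $T\in\Omega\Big(\big(\tfrac{H}{\sigma}\big)^{\frac{2}{3(p+\nu)-2}}\big(\tfrac{\sigma}{\epsilon}\big)^{\frac{2(q-p-\nu)}{q(3(p+\nu)-2)}}\Big)$ steps are needed to reach an $\epsilon$-approximate solution.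
   Context: $\|\cdot\|$ denotes the Euclidean norm on vectors and the induced $\ell_2$ operator norm on symmetric tensors. A function $f:\mathbb R^d\to\mathbb R$ is $p$-th order Hölder smooth with degree $\nu\in(0,1]$ and modulus $H>0$ if it is $p$ times differentiable and $\|\nabla^p f(\mathbf x)-\nabla^p f(\mathbf y)\|\le H\|\mathbf x-\mathbf y\|^\nu$ for all $\mathbf x,\mathbf y\in\mathbb R^d$. A function $F:\mathbb R^d\to\mathbb R$ is uniformly convex with degree $q\ge2$ and modulus $\sigma>0$ if $F(\mathbf y)-F(\mathbf x)-\langle\nabla F(\mathbf x),\mathbf y-\mathbf x\rangle\ge\frac{\sigma}{q}\|\mathbf y-\mathbf x\|^q$ for all $\mathbf x,\mathbf y$, or $\langle\nabla F(\mathbf y)-\nabla F(\mathbf x),\mathbf y-\mathbf x\rangle\ge\sigma\|\mathbf y-\mathbf x\|^q$ for all $\mathbf x,\mathbf y$ (the paper lists these two as alternative forms of the definition). A $T$-step deterministic algorithm with oracle access up to the $p$-th order is a rule that chooses a first point $\mathbf x_1\in\mathbb R^d$ independently of $F$ and then, for $2\le t\le T$, chooses $\mathbf x_t$ as a deterministic function of the oracle answers $\big(F(\mathbf x_s),\nabla F(\mathbf x_s),\dots,\nabla^pF(\mathbf x_s)\big)$, $1\le s\le t-1$.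
   Formalization: F is stated to be uniformly convex with modulus σ/2^(q-2) instead of σ (the same for q=2): for q≥3 modulus σ fails at y=-x with ‖x‖ large, where (σ/q)‖x‖^q gives 2σ‖x‖^q against the required (2^q/q)σ‖x‖^q and f grows at most like ‖x‖^(p+ν). *)

theory Defs
  imports "HOL-Analysis.Analysis"
begin

text \<open>
  The constant in the lower bound has to be uniform in the dimension, so the dimension cannot be
  a type. All spaces \<open>\<real>\<^sup>d\<close> are therefore subspaces of one inner product space, the finitely
  supported real sequences, in which \<open>Rd d\<close> consists of the vectors supported on the first \<open>d\<close>
  coordinates. Functions on \<open>\<real>\<^sup>d\<close> are functions on the large space of which only the restriction
  to \<open>Rd d\<close> is ever used; derivatives are taken within \<open>Rd d\<close>.
\<close>

typedef fseq = "{x :: nat \<Rightarrow> real. finite {i. x i \<noteq> 0}}"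
  morphisms coord Abs_fseq
  by (rule exI[of _ "\<lambda>_. 0"]) simp

setup_lifting type_definition_fseq

lemma finite_coord [simp]: "finite {i. coord x i \<noteq> 0}"
  using coord[of x] by simp

lemma fseq_eqI: "(\<And>i. coord x i = coord y i) \<Longrightarrow> x = y"
  by (simp add: coord_inject[symmetric] ext)

instantiation fseq :: real_vector
begin

lift_definition zero_fseq :: fseq is "\<lambda>_. 0" by simp

lift_definition plus_fseq :: "fseq \<Rightarrow> fseq \<Rightarrow> fseq" is "\<lambda>x y i. x i + y i"
proof -
  fix x y :: "nat \<Rightarrow> real"
  assume "finite {i. x i \<noteq> 0}" "finite {i. y i \<noteq> 0}"
  then show "finite {i. x i + y i \<noteq> 0}"
    by (rule rev_finite_subset[OF finite_UnI]) auto
qed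

lift_definition uminus_fseq :: "fseq \<Rightarrow> fseq" is "\<lambda>x i. - x i" by simp

lift_definition minus_fseq :: "fseq \<Rightarrow> fseq \<Rightarrow> fseq" is "\<lambda>x y i. x i - y i"
proof -
  fix x y :: "nat \<Rightarrow> real"
  assume "finite {i. x i \<noteq> 0}" "finite {i. y i \<noteq> 0}"
  then show "finite {i. x i - y i \<noteq> 0}"
    by (rule rev_finite_subset[OF finite_UnI]) auto
qed

lift_definition scaleR_fseq :: "real \<Rightarrow> fseq \<Rightarrow> fseq" is "\<lambda>a x i. a * x i"
  by (erule rev_finite_subset) auto

instance
  by standard
    (rule fseq_eqI; simp add: zero_fseq.rep_eq plus_fseq.rep_eq uminus_fseq.rep_eq
      minus_fseq.rep_eq scaleR_fseq.rep_eq algebra_simps)+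

end

lemma coord_simps [simp]:
  "coord 0 i = 0" "coord (x + y) i = coord x i + coord y i" "coord (- x) i = - coord x i"
  "coord (x - y) i = coord x i - coord y i" "coord (a *\<^sub>R x) i = a * coord x i"
  by (simp_all add: zero_fseq.rep_eq plus_fseq.rep_eq uminus_fseq.rep_eq
      minus_fseq.rep_eq scaleR_fseq.rep_eq)

instantiation fseq :: real_inner
begin

definition inner_fseq :: "fseq \<Rightarrow> fseq \<Rightarrow> real" where
  "inner_fseq x y = (\<Sum>i | coord x i \<noteq> 0. coord x i * coord y i)"

definition norm_fseq :: "fseq \<Rightarrow> real" where
  "norm_fseq x = sqrt (inner x x)"

definition dist_fseq :: "fseq \<Rightarrow> fseq \<Rightarrow> real" where
  "dist_fseq x y = norm (x - y)"

definition sgn_fseq :: "fseq \<Rightarrow> fseq" where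
  "sgn_fseq x = inverse (norm x) *\<^sub>R x"

definition uniformity_fseq :: "(fseq \<times> fseq) filter" where
  "uniformity_fseq = (INF e\<in>{0<..}. principal {(x, y). dist x y < e})"

definition open_fseq :: "fseq set \<Rightarrow> bool" where
  "open_fseq U \<longleftrightarrow> (\<forall>x\<in>U. \<forall>\<^sub>F (x', y) in uniformity. x' = x \<longrightarrow> y \<in> U)"

lemma inner_fseq_superset:
  "finite S \<Longrightarrow> {i. coord x i \<noteq> 0} \<subseteq> S \<Longrightarrow> inner x y = (\<Sum>i\<in>S. coord x i * coord y i)"
  unfolding inner_fseq_def by (rule sum.mono_neutral_left) auto

instance
proof
  fix x y z :: fseq and a :: real
  let ?S = "{i. coord x i \<noteq> 0} \<union> {i. coord y i \<noteq> 0}"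
  have sup: "inner u v = (\<Sum>i\<in>?S. coord u i * coord v i)"
    if "{i. coord u i \<noteq> 0} \<subseteq> ?S" for u v
    using that by (intro inner_fseq_superset) auto
  show "inner x y = inner y x"
    by (subst (1 2) sup) (auto simp: mult.commute)
  show "inner (x + y) z = inner x z + inner y z"
    by (subst (1 2 3) sup) (auto simp: distrib_right sum.distrib)
  show "inner (a *\<^sub>R x) y = a * inner x y"
    by (subst (1 2) sup) (auto simp: sum_distrib_left mult.assoc)
  show "0 \<le> inner x x"
    by (simp add: inner_fseq_def sum_nonneg)
  show "inner x x = 0 \<longleftrightarrow> x = 0"
  proof
    assume "inner x x = 0"
    then have "\<forall>i\<in>{i. coord x i \<noteq> 0}. coord x i * coord x i = 0"
      unfolding inner_fseq_def by (subst (asm) sum_nonneg_eq_0_iff) auto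
    then show "x = 0"
      by (intro fseq_eqI) auto
  qed (simp add: inner_fseq_def)
qed (simp_all add: norm_fseq_def dist_fseq_def sgn_fseq_def uniformity_fseq_def open_fseq_def)

end

definition Rd :: "nat \<Rightarrow> fseq set" where
  "Rd d = {x. \<forall>i\<ge>d. coord x i = 0}"

lemma subspace_Rd: "subspace (Rd d)"
  by (auto simp: Rd_def subspace_def)

lemma inner_Rd: "x \<in> Rd d \<Longrightarrow> inner x y = (\<Sum>i<d. coord x i * coord y i)"
  by (rule inner_fseq_superset) (simp_all add: Rd_def subset_iff, meson not_le)

lemma norm_Rd: "x \<in> Rd d \<Longrightarrow> norm x = sqrt (\<Sum>i<d. (coord x i)\<^sup>2)"
  by (simp add: norm_eq_sqrt_inner inner_Rd power2_eq_square)

lemma bij_betw_Rd: "bij_betw (\<lambda>x. restrict (coord x) {..<d}) (Rd d) ({..<d} \<rightarrow>\<^sub>E UNIV)"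
proof (rule bij_betw_imageI)
  show "inj_on (\<lambda>x. restrict (coord x) {..<d}) (Rd d)"
  proof (rule inj_onI, rule fseq_eqI)
    fix x y i
    assume xy: "x \<in> Rd d" "y \<in> Rd d" "restrict (coord x) {..<d} = restrict (coord y) {..<d}"
    show "coord x i = coord y i"
    proof (cases "i < d")
      case True
      then show ?thesis
        using fun_cong[OF xy(3), of i] by (simp add: restrict_def)
    next
      case False
      then show ?thesis
        using xy(1,2) by (simp add: Rd_def)
    qed
  qed
  show "(\<lambda>x. restrict (coord x) {..<d}) ` Rd d = {..<d} \<rightarrow>\<^sub>E UNIV"
  proof (intro equalityI subsetI)
    fix g :: "nat \<Rightarrow> real"
    assume g: "g \<in> {..<d} \<rightarrow>\<^sub>E UNIV"
    let ?x = "Abs_fseq (\<lambda>i. if i < d then g i else 0)"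
    have "finite {i. (if i < d then g i else 0) \<noteq> 0}"
      by (rule finite_subset[of _ "{..<d}"]) auto
    then have c: "coord ?x i = (if i < d then g i else 0)" for i
      by (simp add: Abs_fseq_inverse)
    have "?x \<in> Rd d"
      by (simp add: c Rd_def)
    moreover have "restrict (coord ?x) {..<d} = g"
    proof
      fix i
      show "restrict (coord ?x) {..<d} i = g i"
        using PiE_arb[OF g, of i] by (cases "i < d") (simp_all add: c)
    qed
    ultimately show "g \<in> (\<lambda>x. restrict (coord x) {..<d}) ` Rd d"
      by (intro image_eqI[of _ _ ?x]) simp_all
  qed (auto simp: restrict_def split: if_splits)
qed

text \<open>
  \<open>nabla d f [v\<^sub>1, \<dots>, v\<^sub>k] x\<close> is the value \<open>\<nabla>\<^sup>k f(x)[v\<^sub>1, \<dots>, v\<^sub>k]\<close> of the \<open>k\<close>-th derivative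
  tensor, obtained by iterating the Frechet derivative within \<open>Rd d\<close>; in particular
  \<open>nabla d f [v] x\<close> is the inner product of the gradient at \<open>x\<close> with \<open>v\<close>. It is meaningful only
  for \<open>x\<close> and all \<open>v\<^sub>i\<close> in \<open>Rd d\<close>.
\<close>

primrec nabla :: "nat \<Rightarrow> (fseq \<Rightarrow> real) \<Rightarrow> fseq list \<Rightarrow> fseq \<Rightarrow> real" where
  "nabla d f [] = f"
| "nabla d f (v # vs) = (\<lambda>x. frechet_derivative (nabla d f vs) (at x within Rd d) v)"

text \<open>
  Since \<open>Rd d\<close> has finite dimension, Frechet differentiability of the tensor-valued map
  \<open>\<nabla>\<^sup>k f\<close> is the same as that of each of its evaluations at \<open>k\<close> fixed directions.
\<close>

definition times_differentiable :: "nat \<Rightarrow> nat \<Rightarrow> (fseq \<Rightarrow> real) \<Rightarrow> bool" where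
  "times_differentiable d p f \<longleftrightarrow>
    (\<forall>vs. set vs \<subseteq> Rd d \<and> length vs < p \<longrightarrow> nabla d f vs differentiable_on Rd d)"

definition tensor_norm :: "nat \<Rightarrow> nat \<Rightarrow> (fseq list \<Rightarrow> real) \<Rightarrow> real" where
  "tensor_norm d k A =
    (SUP vs \<in> {vs. length vs = k \<and> (\<forall>v\<in>set vs. v \<in> Rd d \<and> norm v \<le> 1)}. \<bar>A vs\<bar>)"

definition holder_smooth :: "nat \<Rightarrow> nat \<Rightarrow> real \<Rightarrow> real \<Rightarrow> (fseq \<Rightarrow> real) \<Rightarrow> bool" where
  "holder_smooth d p \<nu> H f \<longleftrightarrow> times_differentiable d p f \<and>
    (\<forall>x\<in>Rd d. \<forall>y\<in>Rd d.
      tensor_norm d p (\<lambda>vs. nabla d f vs x - nabla d f vs y) \<le> H * norm (x - y) powr \<nu>)"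

text \<open>
  The two inequalities are used in the literature as alternative definitions of uniform
  convexity; we ask for both of them. A pitfall: the function \<open>(\<sigma>/q) \<parallel>x\<parallel>\<^sup>q\<close> is uniformly convex
  of degree \<open>q\<close> with modulus \<open>\<sigma> / 2\<^sup>q\<^sup>-\<^sup>2\<close>, and \<open>y = -x\<close> shows that this constant is the largest
  possible one. For \<open>q \<ge> 3\<close> the modulus is not \<open>\<sigma>\<close>, with respect to either inequality.
\<close>

definition uniformly_convex :: "nat \<Rightarrow> nat \<Rightarrow> real \<Rightarrow> (fseq \<Rightarrow> real) \<Rightarrow> bool" where
  "uniformly_convex d q \<sigma> F \<longleftrightarrow> times_differentiable d 1 F \<and>
    (\<forall>x\<in>Rd d. \<forall>y\<in>Rd d. F y - F x - nabla d F [y - x] x \<ge> \<sigma> / real q * norm (y - x) ^ q) \<and>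
    (\<forall>x\<in>Rd d. \<forall>y\<in>Rd d. nabla d F [y - x] y - nabla d F [y - x] x \<ge> \<sigma> * norm (y - x) ^ q)"

text \<open>
  The answer \<open>(F(x), \<nabla>F(x), \<dots>, \<nabla>\<^sup>p F(x))\<close> is encoded as a single function, the tensor of order \<open>k\<close>
  being its restriction to lists of length \<open>k\<close>. The cut-off to \<open>0\<close> elsewhere makes sure that an
  answer carries no other information about \<open>F\<close>.
\<close>

definition local_info :: "nat \<Rightarrow> nat \<Rightarrow> (fseq \<Rightarrow> real) \<Rightarrow> fseq \<Rightarrow> (fseq list \<Rightarrow> real)" where
  "local_info d p F x = (\<lambda>vs. if length vs \<le> p \<and> set vs \<subseteq> Rd d then nabla d F vs x else 0)"

text \<open>
  A deterministic algorithm maps the list of the answers received so far to the next query point;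
  its value at \<open>[]\<close> is the first point. \<open>answers d p A F t\<close> lists the first \<open>t\<close> answers, in
  chronological order.
\<close>

type_synonym algorithm = "(fseq list \<Rightarrow> real) list \<Rightarrow> fseq"

definition is_algorithm :: "nat \<Rightarrow> nat \<Rightarrow> algorithm \<Rightarrow> bool" where
  "is_algorithm d T A \<longleftrightarrow> (\<forall>as. length as < T \<longrightarrow> A as \<in> Rd d)"

primrec answers :: "nat \<Rightarrow> nat \<Rightarrow> algorithm \<Rightarrow> (fseq \<Rightarrow> real) \<Rightarrow> nat \<Rightarrow> (fseq list \<Rightarrow> real) list" where
  "answers d p A F 0 = []"
| "answers d p A F (Suc t) = answers d p A F t @ [local_info d p F (A (answers d p A F t))]"

text \<open>The points are \<open>iterate d p A F 1\<close>, ..., \<open>iterate d p A F T\<close>.\<close>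

definition iterate :: "nat \<Rightarrow> nat \<Rightarrow> algorithm \<Rightarrow> (fseq \<Rightarrow> real) \<Rightarrow> nat \<Rightarrow> fseq" where
  "iterate d p A F t = A (answers d p A F (t - 1))"

end

theory Submission
  imports Defs
begin

text \<open>
  The hard function is \<open>f(x) = a Z(b x)\<close>, where \<open>Z\<close> is a smooth version of
  \<open>max\<^sub>i (\<xi>\<^sub>i x\<^bsub>k(i)\<^esub> - i)\<close> over \<open>T\<close> distinct coordinates \<open>k(i)\<close> with signs \<open>\<xi>\<^sub>i\<close>. It is built from the last
  link backwards by \<open>Z\<^sub>i = y\<^sub>i + h(Z\<^sub>i\<^sub>+\<^sub>1 - y\<^sub>i)\<close> with a smooth hinge \<open>h\<close> that vanishes on the negative axis and
  whose second derivative is a Gamma density. All higher derivatives of \<open>h\<close> are dominated by \<open>1 - h'\<close>,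
  so \<open>\<nabla>\<^sup>k Z\<^sub>i\<close> is a convex combination of \<open>\<nabla>\<^sup>k Z\<^sub>i\<^sub>+\<^sub>1\<close> and bounded terms, and its norm is bounded
  independently of \<open>T\<close> and of the dimension.

  Since \<open>h\<close> vanishes exactly on the negative axis, a link that is largest among the links not yet
  disclosed hides all later ones, including their derivatives. The adversary therefore discloses
  one coordinate per query and chooses its sign so that the new link is nonnegative at the query
  point. Hence \<open>Z\<close> is at least of order \<open>-T\<close> at \<open>x\<^sub>T\<close>, whereas it is much smaller at a point with all
  \<open>\<xi>\<^sub>i x\<^bsub>k(i)\<^esub>\<close> equal to a large negative multiple of \<open>T\<close>. The rate results from optimising \<open>b\<close>, with
  \<open>a\<close> of order \<open>H b\<^sup>-\<^sup>(\<^sup>p\<^sup>+\<^sup>\<nu>\<^sup>)\<close>.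
\<close>

section \<open>A smooth hinge from Gamma densities\<close>

text \<open>For \<open>s \<ge> 0\<close> this is the Gamma density of shape \<open>j + 1\<close> and
  rate 1; as a function of \<open>j\<close>, it is the Poisson weight with mean
  \<open>s\<close>.\<close>

definition gam :: "nat \<Rightarrow> real \<Rightarrow> real" where
  "gam j s = exp (- s) * s ^ j / fact j"

definition gam_sum :: "nat \<Rightarrow> real \<Rightarrow> real" where
  "gam_sum n s = (\<Sum>j<n. gam j s)"

definition gam_plus :: "nat \<Rightarrow> real \<Rightarrow> real" where
  "gam_plus j s = (if s < 0 then 0 else gam j s)"

text \<open>For a Gamma variable \<open>G\<close> of shape \<open>n \<ge> 1\<close> this is the
  probability of \<open>G > s\<close>, by the duality between Gamma tails and Poisson sums.\<close>

definition gam_tail :: "nat \<Rightarrow> real \<Rightarrow> real" where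
  "gam_tail n s = (if s < 0 then 1 else gam_sum n s)"

text \<open>The expectation of \<open>max 0 (s - G)\<close> for the same \<open>G\<close>, in closed
  form: \<open>n\<close> is the mean of \<open>G\<close>, and the sum is the integral of
  \<open>gam_sum n\<close> from \<open>s\<close> to infinity, that is, the expectation of
  \<open>max 0 (G - s)\<close>.\<close>

definition hinge :: "nat \<Rightarrow> real \<Rightarrow> real" where
  "hinge n s = (if s < 0 then 0 else s - real n + (\<Sum>m<n. gam_sum (Suc m) s))"

lemma gam_nonneg: "0 \<le> s \<Longrightarrow> 0 \<le> gam j s"
  by (simp add: gam_def)

lemma gam_0: "gam j 0 = (if j = 0 then 1 else 0)"
  by (simp add: gam_def)

lemma gam_sum_nonneg: "0 \<le> s \<Longrightarrow> 0 \<le> gam_sum n s"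
  unfolding gam_sum_def by (intro sum_nonneg gam_nonneg)

lemma gam_sum_0: "gam_sum (Suc n) 0 = 1"
  by (induction n) (simp_all add: gam_sum_def gam_0)

lemma DERIV_gam_0: "(gam 0 has_real_derivative - gam 0 s) (at s)"
  unfolding gam_def by (auto intro!: derivative_eq_intros)

lemma DERIV_gam_Suc: "(gam (Suc j) has_real_derivative gam j s - gam (Suc j) s) (at s)"
proof -
  have "((\<lambda>s. exp (- s) * s ^ Suc j) has_real_derivative
      exp (- s) * (real (Suc j) * s ^ j) - exp (- s) * s ^ Suc j) (at s)"
    by (rule derivative_eq_intros refl)+ (simp add: algebra_simps)
  then have "((\<lambda>s. exp (- s) * s ^ Suc j / fact (Suc j)) has_real_derivative
      exp (- s) * (real (Suc j) * s ^ j) / fact (Suc j) - exp (- s) * s ^ Suc j / fact (Suc j)) (at s)"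
    unfolding diff_divide_distrib[symmetric] by (rule DERIV_cdivide)
  moreover have "exp (- s) * (real (Suc j) * s ^ j) / fact (Suc j) = gam j s"
    unfolding gam_def fact_Suc of_nat_mult
    by (simp only: mult.left_commute[of "exp (- s)"] mult_divide_mult_cancel_left[of "real (Suc j)"]
        of_nat_eq_0_iff nat.distinct not_False_eq_True of_nat_fact)
  moreover have "gam (Suc j) = (\<lambda>s. exp (- s) * s ^ Suc j / fact (Suc j))"
    by (rule ext) (simp only: gam_def)
  ultimately show ?thesis
    by simp
qed

lemma DERIV_gam_sum: "(gam_sum (Suc n) has_real_derivative - gam n s) (at s)"
proof (induction n)
  case 0
  have "gam_sum (Suc 0) = gam 0"
    by (simp add: gam_sum_def fun_eq_iff)
  then show ?case
    using DERIV_gam_0 by simp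
next
  case (Suc n)
  have "gam_sum (Suc (Suc n)) = (\<lambda>s. gam_sum (Suc n) s + gam (Suc n) s)"
    by (simp add: gam_sum_def fun_eq_iff)
  then show ?case
    using DERIV_add[OF Suc DERIV_gam_Suc[of n s]] by simp
qed

text \<open>Only the point 0 is delicate. There the difference quotient of the cut function is
  dominated by that of \<open>g\<close>, which tends to \<open>g' 0 = 0\<close>.\<close>

lemma DERIV_cut:
  fixes g :: "real \<Rightarrow> real"
  assumes g: "\<And>s. (g has_real_derivative g' s) (at s)" and "g 0 = 0" "g' 0 = 0"
  shows "((\<lambda>s. if s < 0 then 0 else g s) has_real_derivative (if s < 0 then 0 else g' s)) (at s)"
proof (cases s "0 :: real" rule: linorder_cases)
  case less
  have "((\<lambda>s. 0) has_real_derivative 0) (at s)" by simp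
  then show ?thesis using less
    by (subst has_field_derivative_cong_ev[where g = "\<lambda>s. 0" and y = s and t = UNIV])
      (auto intro!: eventually_mono[OF eventually_nhds_in_open[of "{..<0}"]])
next
  case greater
  then show ?thesis using g[of s]
    by (subst has_field_derivative_cong_ev[where g = g and y = s and t = UNIV])
      (auto intro!: eventually_mono[OF eventually_nhds_in_open[of "{0<..}"]])
next
  case equal
  have "((\<lambda>h. g h / h) \<longlongrightarrow> 0) (at 0)"
    using g[of 0] assms(2,3) by (simp add: DERIV_def)
  then have "((\<lambda>h. norm (g h / h)) \<longlongrightarrow> 0) (at 0)"
    by (rule tendsto_norm_zero)
  then have "((\<lambda>h. (if h < 0 then 0 else g h) / h) \<longlongrightarrow> 0) (at 0)"
    by (rule Lim_null_comparison[rotated]) (auto intro!: always_eventually simp: divide_nonneg_neg)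
  then show ?thesis
    using equal assms(2,3) by (simp add: DERIV_def cong: if_cong)
qed

text \<open>The index starts at 2 because \<open>DERIV_cut\<close> needs the derivative to vanish at
  0 as well; \<open>gam_plus 1\<close> has a corner there. Every differentiation uses up one index,
  so the shape parameter has to grow with the order of smoothness.\<close>

lemma DERIV_gam_plus:
  "(gam_plus (Suc (Suc j)) has_real_derivative gam_plus (Suc j) s - gam_plus (Suc (Suc j)) s) (at s)"
proof -
  have "(gam_plus (Suc (Suc j)) has_real_derivative
      (if s < 0 then 0 else gam (Suc j) s - gam (Suc (Suc j)) s)) (at s)"
    unfolding gam_plus_def[abs_def]
    by (rule DERIV_cut[OF DERIV_gam_Suc]) (simp_all add: gam_0)
  then show ?thesis
    by (simp add: gam_plus_def split: if_splits)
qed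

lemma DERIV_gam_tail:
  "(gam_tail (Suc (Suc n)) has_real_derivative - gam_plus (Suc n) s) (at s)"
proof -
  have "((\<lambda>s. if s < 0 then 0 else gam_sum (Suc (Suc n)) s - 1) has_real_derivative
      (if s < 0 then 0 else - gam (Suc n) s)) (at s)"
    by (rule DERIV_cut) (auto intro!: derivative_eq_intros DERIV_gam_sum simp: gam_0 gam_sum_0)
  then have "((\<lambda>s. 1 + (if s < 0 then 0 else gam_sum (Suc (Suc n)) s - 1)) has_real_derivative
      (if s < 0 then 0 else - gam (Suc n) s)) (at s)"
    by (auto intro!: derivative_eq_intros)
  moreover have "(\<lambda>s. 1 + (if s < 0 then 0 else gam_sum (Suc (Suc n)) s - 1)) = gam_tail (Suc (Suc n))"
    by (auto simp: gam_tail_def fun_eq_iff)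
  ultimately show ?thesis
    by (simp add: gam_plus_def split: if_splits)
qed

lemma DERIV_hinge_pos_part:
  "((\<lambda>s. s - real n + (\<Sum>m<n. gam_sum (Suc m) s)) has_real_derivative 1 - gam_sum n s) (at s)"
proof -
  have "((\<lambda>s. \<Sum>m<n. gam_sum (Suc m) s) has_real_derivative (\<Sum>m<n. - gam m s)) (at s)"
    by (intro DERIV_sum DERIV_gam_sum)
  then have "((\<lambda>s. s - real n + (\<Sum>m<n. gam_sum (Suc m) s)) has_real_derivative
      1 - 0 + (\<Sum>m<n. - gam m s)) (at s)"
    by (intro DERIV_add DERIV_diff DERIV_ident DERIV_const)
  then show ?thesis
    by (simp add: sum_negf gam_sum_def)
qed

lemma hinge_pos_part_0: "0 - real n + (\<Sum>m<n. gam_sum (Suc m) 0) = 0"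
  by (simp add: gam_sum_0)

lemma DERIV_hinge: "(hinge (Suc n) has_real_derivative 1 - gam_tail (Suc n) s) (at s)"
proof -
  have "(hinge (Suc n) has_real_derivative (if s < 0 then 0 else 1 - gam_sum (Suc n) s)) (at s)"
    unfolding hinge_def[abs_def]
    by (rule DERIV_cut[OF DERIV_hinge_pos_part]) (simp_all add: gam_sum_0)
  then show ?thesis
    by (simp add: gam_tail_def split: if_splits)
qed

lemma gam_tail_nonneg: "0 \<le> gam_tail n s"
  by (simp add: gam_tail_def gam_sum_nonneg)

lemma gam_tail_le_1: "gam_tail (Suc n) s \<le> 1"
proof (cases "s < 0")
  case False
  have "gam_sum (Suc n) s \<le> gam_sum (Suc n) 0"
    by (rule DERIV_nonpos_imp_nonincreasing[of 0 s])
      (use False in \<open>auto intro!: exI DERIV_gam_sum gam_nonneg\<close>)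
  then show ?thesis
    using False by (simp add: gam_tail_def gam_sum_0)
qed (simp add: gam_tail_def)

text \<open>This domination is what makes the derivative bounds independent of the length of a chain.\<close>

lemma gam_plus_le_gam_tail:
  assumes "j < n"
  shows "\<bar>gam_plus j s\<bar> \<le> gam_tail n s"
proof (cases "s < 0")
  case False
  have "gam j s \<le> gam_sum n s"
    unfolding gam_sum_def using assms False by (intro member_le_sum gam_nonneg) auto
  then show ?thesis
    using False gam_nonneg[of s j] by (simp add: gam_plus_def gam_tail_def)
qed (simp add: gam_plus_def gam_tail_def)

text \<open>On the positive side the difference is a sum of probabilities. The lemma limits what a
  single link of a chain can lose.\<close>

lemma hinge_ge: "s - real n \<le> hinge n s"
  by (auto simp: hinge_def intro!: sum_nonneg gam_sum_nonneg)

lemma hinge_mono: "s \<le> t \<Longrightarrow> hinge (Suc n) s \<le> hinge (Suc n) t"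
  by (rule DERIV_nonneg_imp_nondecreasing) (auto intro!: exI DERIV_hinge simp: gam_tail_le_1)

text \<open>Vanishing exactly, rather than being merely small, is what lets a link hide all later
  ones from the oracle.\<close>

lemma hinge_nonpos_arg: "s \<le> 0 \<Longrightarrow> hinge n s = 0"
  using hinge_pos_part_0[of n] by (cases "s = 0") (auto simp: hinge_def)

lemma hinge_nonneg: "0 \<le> hinge (Suc n) s"
  by (cases "s \<le> 0") (use hinge_nonpos_arg hinge_mono[of 0 s] in \<open>auto\<close>)

lemma hinge_le: "hinge (Suc n) s \<le> max 0 s"
proof (cases "s \<le> 0")
  case False
  have "((\<lambda>s. s - hinge (Suc n) s) has_real_derivative gam_tail (Suc n) s) (at s)" for s
    by (auto intro!: derivative_eq_intros DERIV_hinge)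
  then have "0 - hinge (Suc n) 0 \<le> s - hinge (Suc n) s"
    by (intro DERIV_nonneg_imp_nondecreasing[of 0 s "\<lambda>s. s - hinge (Suc n) s"])
      (use False gam_tail_nonneg in \<open>auto intro!: exI\<close>)
  then show ?thesis
    by (simp add: hinge_nonpos_arg)
qed (simp add: hinge_nonpos_arg)

lemma convex_hinge: "convex_on UNIV (hinge (Suc (Suc n)))"
proof (rule f''_ge0_imp_convex)
  show "(hinge (Suc (Suc n)) has_real_derivative 1 - gam_tail (Suc (Suc n)) s) (at s)" for s
    by (rule DERIV_hinge)
  show "((\<lambda>s. 1 - gam_tail (Suc (Suc n)) s) has_real_derivative gam_plus (Suc n) s) (at s)" for s
    by (auto intro!: derivative_eq_intros DERIV_gam_tail)
  show "0 \<le> gam_plus (Suc n) s" for s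
    by (simp add: gam_plus_def gam_nonneg)
qed simp

section \<open>Calculus of directional derivatives\<close>

lemma Rd_add: "x \<in> Rd d \<Longrightarrow> y \<in> Rd d \<Longrightarrow> x + y \<in> Rd d"
  by (rule subspace_add[OF subspace_Rd])

lemma Rd_diff: "x \<in> Rd d \<Longrightarrow> y \<in> Rd d \<Longrightarrow> x - y \<in> Rd d"
  by (rule subspace_diff[OF subspace_Rd])

lemma Rd_scale: "x \<in> Rd d \<Longrightarrow> a *\<^sub>R x \<in> Rd d"
  by (rule subspace_scale[OF subspace_Rd])

lemma Rd_0: "0 \<in> Rd d"
  by (rule subspace_0[OF subspace_Rd])

lemma has_real_derivative_line:
  assumes g: "(g has_derivative D) (at (x + t *\<^sub>R v) within Rd d)" and x: "x \<in> Rd d" and v: "v \<in> Rd d"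
  shows "((\<lambda>t. g (x + t *\<^sub>R v)) has_real_derivative D v) (at t)"
proof -
  let ?l = "\<lambda>t. x + t *\<^sub>R v"
  have "((\<lambda>t. g (?l t)) has_derivative (\<lambda>s. D (s *\<^sub>R v))) (at t)"
  proof (rule has_derivative_in_compose[where f = ?l and f' = "\<lambda>s. s *\<^sub>R v"])
    show "(?l has_derivative (\<lambda>s. s *\<^sub>R v)) (at t)"
      by (auto intro!: derivative_eq_intros)
    show "(g has_derivative D) (at (?l t) within range ?l)"
      by (rule has_derivative_subset[OF g]) (auto intro: Rd_add Rd_scale x v)
  qed
  moreover have "(\<lambda>s. D (s *\<^sub>R v)) = (*) (D v)"
    using linear_cmul[OF has_derivative_linear[OF g]] by (auto simp: mult.commute)
  ultimately show ?thesis
    unfolding has_field_derivative_def by simp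
qed

text \<open>
  \<^term>\<open>Rd d\<close> has empty interior in the ambient space, so a derivative within it is unique only in
  the directions of \<^term>\<open>Rd d\<close>.
\<close>

lemma nabla_ConsI:
  assumes D: "(nabla d f vs has_derivative D) (at x within Rd d)" and x: "x \<in> Rd d" and v: "v \<in> Rd d"
  shows "nabla d f (v # vs) x = D v"
proof -
  have "(nabla d f vs has_derivative (\<lambda>v. nabla d f (v # vs) x)) (at x within Rd d)"
    using differentiableI[OF D] frechet_derivative_works[of "nabla d f vs"] by simp
  then have "((\<lambda>t. nabla d f vs (x + t *\<^sub>R v)) has_real_derivative nabla d f (v # vs) x) (at 0)"
    using has_real_derivative_line[of "nabla d f vs" "\<lambda>v. nabla d f (v # vs) x" x 0 v d] x v by simp
  moreover have "((\<lambda>t. nabla d f vs (x + t *\<^sub>R v)) has_real_derivative D v) (at 0)"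
    using has_real_derivative_line[of "nabla d f vs" D x 0 v d] D x v by simp
  ultimately show ?thesis
    by (rule DERIV_unique)
qed

lemma nabla_has_derivative:
  assumes "nabla d f vs differentiable_on Rd d" "x \<in> Rd d"
  shows "(nabla d f vs has_derivative (\<lambda>v. nabla d f (v # vs) x)) (at x within Rd d)"
  using assms frechet_derivative_works[of "nabla d f vs"] by (simp add: differentiable_on_def)

lemma nabla_single_has_derivative:
  assumes "f differentiable_on Rd d" "x \<in> Rd d"
  shows "(f has_derivative (\<lambda>v. nabla d f [v] x)) (at x within Rd d)"
  using nabla_has_derivative[of d f "[]" x] assms by simp

lemma nabla_singleI:
  assumes "(f has_derivative D) (at x within Rd d)" "x \<in> Rd d" "v \<in> Rd d"
  shows "nabla d f [v] x = D v"
  using nabla_ConsI[of d f "[]" D x v] assms by simp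

text \<open>The last entry of a list of directions is differentiated first. Splitting
  \<open>vs = ws @ [v]\<close> therefore reduces the order of derivatives of \<open>f\<close> by
  passing to \<open>nabla d f [v]\<close>, and the inductions on the order proceed in this
  way.\<close>

lemma nabla_append: "nabla d f (vs @ ws) = nabla d (nabla d f ws) vs"
  by (induction vs) simp_all

text \<open>Derivatives within \<open>Rd d\<close> depend only on the germ of the function; this
  turns local agreement of two functions into equality of oracle answers.\<close>

lemma nabla_cong_open:
  assumes U: "open U" and eq: "\<And>x. x \<in> U \<inter> Rd d \<Longrightarrow> f x = g x"
  shows "x \<in> U \<inter> Rd d \<Longrightarrow> nabla d f vs x = nabla d g vs x"
proof (induction vs arbitrary: x)
  case Nil
  then show ?case by (simp add: eq)
next
  case (Cons v vs)
  obtain e where e: "e > 0" "\<And>y. dist y x < e \<Longrightarrow> y \<in> U"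
    using U Cons.prems unfolding open_dist by blast
  have eq': "nabla d f vs y = nabla d g vs y" if "y \<in> Rd d" "dist y x < e" for y
    using that e Cons.IH by auto
  \<comment> \<open>\<open>frechet_derivative\<close> is a choice among all derivatives, so it
    suffices that both functions have the same set of candidates. This also covers points where
    neither is differentiable.\<close>
  have "(nabla d f vs has_derivative D) (at x within Rd d) \<longleftrightarrow>
      (nabla d g vs has_derivative D) (at x within Rd d)" for D
    using Cons.prems eq'
    by (intro iffI; elim has_derivative_transform_within[OF _ e(1)]) auto
  then show ?case
    by (simp add: frechet_derivative_def)
qed

lemma nabla_cong:
  assumes "\<And>x. x \<in> Rd d \<Longrightarrow> f x = g x" "x \<in> Rd d"
  shows "nabla d f vs x = nabla d g vs x"
  using nabla_cong_open[of UNIV d f g x vs] assms by simp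

lemma nabla_Cons_cong:
  assumes "\<And>x. x \<in> Rd d \<Longrightarrow> nabla d f vs x = G x"
    and "(G has_derivative D) (at x within Rd d)" "x \<in> Rd d"
  shows "(nabla d f vs has_derivative D) (at x within Rd d)"
  using has_derivative_transform[of x "Rd d" "nabla d f vs" G D] assms by simp

lemma differentiable_on_cong:
  assumes "\<And>x. x \<in> S \<Longrightarrow> f x = g x" "f differentiable_on S"
  shows "g differentiable_on S"
  unfolding differentiable_on_def
proof
  fix x assume x: "x \<in> S"
  then obtain D where "(f has_derivative D) (at x within S)"
    using assms(2) unfolding differentiable_on_def differentiable_def by blast
  then have "(g has_derivative D) (at x within S)"
    by (rule has_derivative_transform[OF x, rotated]) (simp add: assms(1))
  then show "g differentiable (at x within S)"
    unfolding differentiable_def by blast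
qed

lemma times_differentiable_cong:
  assumes eq: "\<And>x. x \<in> Rd d \<Longrightarrow> f x = g x" and f: "times_differentiable d k f"
  shows "times_differentiable d k g"
  unfolding times_differentiable_def
proof (intro allI impI)
  fix vs assume "set vs \<subseteq> Rd d \<and> length vs < k"
  then have "nabla d f vs differentiable_on Rd d"
    using f unfolding times_differentiable_def by blast
  then show "nabla d g vs differentiable_on Rd d"
    by (rule differentiable_on_cong[rotated]) (rule nabla_cong[OF eq])
qed

lemma times_differentiable_mono:
  "times_differentiable d k f \<Longrightarrow> j \<le> k \<Longrightarrow> times_differentiable d j f"
  by (auto simp: times_differentiable_def)

lemma times_differentiable_0: "times_differentiable d 0 f"
  by (simp add: times_differentiable_def)

lemma times_differentiable_Suc:
  "times_differentiable d (Suc k) f \<longleftrightarrow>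
    f differentiable_on Rd d \<and> (\<forall>v\<in>Rd d. times_differentiable d k (nabla d f [v]))"
proof (intro iffI conjI ballI)
  assume f: "times_differentiable d (Suc k) f"
  show "f differentiable_on Rd d"
    using f[unfolded times_differentiable_def, rule_format, of "[]"] by simp
  fix v assume "v \<in> Rd d"
  then show "times_differentiable d k (nabla d f [v])"
    using f unfolding times_differentiable_def nabla_append[symmetric] by auto
next
  assume f: "f differentiable_on Rd d \<and> (\<forall>v\<in>Rd d. times_differentiable d k (nabla d f [v]))"
  show "times_differentiable d (Suc k) f"
    unfolding times_differentiable_def
  proof (intro allI impI)
    fix vs assume vs: "set vs \<subseteq> Rd d \<and> length vs < Suc k"
    show "nabla d f vs differentiable_on Rd d"
    proof (cases vs rule: rev_cases)
      case Nil
      then show ?thesis using f by simp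
    next
      case (snoc ws v)
      then show ?thesis
        using f vs by (auto simp: nabla_append times_differentiable_def simp del: nabla.simps)
    qed
  qed
qed

lemma times_differentiable_SucD:
  assumes "times_differentiable d (Suc k) f"
  shows "f differentiable_on Rd d" and "v \<in> Rd d \<Longrightarrow> times_differentiable d k (nabla d f [v])"
  using assms by (auto simp only: times_differentiable_Suc)

section \<open>Linear combinations, products and compositions\<close>

lemma nabla_lincomb:
  assumes f: "times_differentiable d k f" and g: "times_differentiable d k g"
  shows "set vs \<subseteq> Rd d \<Longrightarrow> length vs \<le> k \<Longrightarrow> x \<in> Rd d \<Longrightarrow>
    nabla d (\<lambda>x. a * f x + b * g x) vs x = a * nabla d f vs x + b * nabla d g vs x"
proof (induction vs arbitrary: x)
  case Nil
  then show ?case by simp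
next
  case (Cons v vs)
  have "nabla d f vs differentiable_on Rd d" "nabla d g vs differentiable_on Rd d"
    using f g Cons.prems by (auto simp: times_differentiable_def)
  then have "((\<lambda>x. a * nabla d f vs x + b * nabla d g vs x) has_derivative
      (\<lambda>v. a * nabla d f (v # vs) x + b * nabla d g (v # vs) x)) (at x within Rd d)"
    using Cons.prems by (intro has_derivative_add has_derivative_mult_right nabla_has_derivative)
  then have "(nabla d (\<lambda>x. a * f x + b * g x) vs has_derivative
      (\<lambda>v. a * nabla d f (v # vs) x + b * nabla d g (v # vs) x)) (at x within Rd d)"
    by (rule nabla_Cons_cong[rotated]) (use Cons in auto)
  then show ?case
    using Cons.prems by (intro nabla_ConsI) auto
qed

lemma times_differentiable_lincomb:
  assumes f: "times_differentiable d k f" and g: "times_differentiable d k g"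
  shows "times_differentiable d k (\<lambda>x. a * f x + b * g x)"
  unfolding times_differentiable_def
proof (intro allI impI)
  fix vs assume vs: "set vs \<subseteq> Rd d \<and> length vs < k"
  have "nabla d f vs differentiable_on Rd d" "nabla d g vs differentiable_on Rd d"
    using f g vs by (auto simp: times_differentiable_def)
  then have "(\<lambda>x. a * nabla d f vs x + b * nabla d g vs x) differentiable_on Rd d"
    by (intro differentiable_on_add differentiable_on_mult) auto
  then show "nabla d (\<lambda>x. a * f x + b * g x) vs differentiable_on Rd d"
    by (rule differentiable_on_cong[rotated]) (use vs in \<open>auto simp: nabla_lincomb[OF f g]\<close>)
qed

lemma nabla_mult_single:
  assumes "f differentiable_on Rd d" "g differentiable_on Rd d" "x \<in> Rd d" "v \<in> Rd d"
  shows "nabla d (\<lambda>x. f x * g x) [v] x = nabla d f [v] x * g x + f x * nabla d g [v] x"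
proof -
  have "((\<lambda>x. f x * g x) has_derivative (\<lambda>v. f x * nabla d g [v] x + nabla d f [v] x * g x))
      (at x within Rd d)"
    by (intro has_derivative_mult nabla_single_has_derivative assms)
  then show ?thesis
    using nabla_singleI assms by fastforce
qed

lemma times_differentiable_mult:
  "times_differentiable d k f \<Longrightarrow> times_differentiable d k g \<Longrightarrow>
    times_differentiable d k (\<lambda>x. f x * g x)"
proof (induction k arbitrary: f g)
  case (Suc k)
  note f = times_differentiable_SucD[OF Suc.prems(1)] and g = times_differentiable_SucD[OF Suc.prems(2)]
  have "times_differentiable d k (nabla d (\<lambda>x. f x * g x) [v])" if v: "v \<in> Rd d" for v
  proof (rule times_differentiable_cong)
    have "times_differentiable d k f" "times_differentiable d k g"
      by (rule times_differentiable_mono[OF Suc.prems(1)] times_differentiable_mono[OF Suc.prems(2)]; simp)+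
    then show "times_differentiable d k (\<lambda>x. 1 * (nabla d f [v] x * g x) + 1 * (f x * nabla d g [v] x))"
      by (intro times_differentiable_lincomb Suc.IH f(2) g(2) v)
  qed (simp add: nabla_mult_single[OF f(1) g(1) _ v] del: nabla.simps)
  moreover have "(\<lambda>x. f x * g x) differentiable_on Rd d"
    using f(1) g(1) by (rule differentiable_on_mult)
  ultimately show ?case
    by (simp only: times_differentiable_Suc) simp
qed (simp add: times_differentiable_0)

lemma has_derivative_comp_real:
  assumes "(\<phi> has_real_derivative \<phi>') (at (u x))" "(u has_derivative D) (at x within S)"
  shows "((\<lambda>x. \<phi> (u x)) has_derivative (\<lambda>v. \<phi>' * D v)) (at x within S)"
  using has_derivative_compose[OF assms(2), of \<phi> "(*) \<phi>'"] assms(1)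
  by (simp add: has_field_derivative_def)

lemma
  assumes \<phi>: "\<And>s. (\<phi> has_real_derivative \<phi>' s) (at s)" and u: "u differentiable_on Rd d"
  shows differentiable_on_comp_real: "(\<lambda>x. \<phi> (u x)) differentiable_on Rd d"
    and nabla_comp_single: "x \<in> Rd d \<Longrightarrow> v \<in> Rd d \<Longrightarrow>
      nabla d (\<lambda>x. \<phi> (u x)) [v] x = \<phi>' (u x) * nabla d u [v] x"
proof -
  have *: "((\<lambda>x. \<phi> (u x)) has_derivative (\<lambda>v. \<phi>' (u x) * nabla d u [v] x)) (at x within Rd d)"
    if "x \<in> Rd d" for x
    by (rule has_derivative_comp_real[where \<phi>' = "\<phi>' (u x)", OF \<phi> nabla_single_has_derivative[OF u that]])
  then show "(\<lambda>x. \<phi> (u x)) differentiable_on Rd d"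
    unfolding differentiable_on_def differentiable_def by blast
  show "x \<in> Rd d \<Longrightarrow> v \<in> Rd d \<Longrightarrow>
      nabla d (\<lambda>x. \<phi> (u x)) [v] x = \<phi>' (u x) * nabla d u [v] x"
    using nabla_singleI[OF *] by simp
qed

section \<open>Bounds on all derivatives up to a given order\<close>

text \<open>The weight \<open>w\<close> makes room for bounds that vary with the point: derivatives
  of a density at \<open>u x\<close> will be measured against
  \<open>gam_tail n (u x)\<close>.\<close>

definition deriv_bound :: "nat \<Rightarrow> nat \<Rightarrow> (fseq \<Rightarrow> real) \<Rightarrow> real \<Rightarrow> (fseq \<Rightarrow> real) \<Rightarrow> bool" where
  "deriv_bound d k w M f \<longleftrightarrow> (\<forall>vs. set vs \<subseteq> Rd d \<and> length vs \<le> k \<longrightarrow>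
    (\<forall>x\<in>Rd d. \<bar>nabla d f vs x\<bar> \<le> M * prod_list (map norm vs) * w x))"

text \<open>Order 0 is left out because chains are in general unbounded.\<close>

definition pos_deriv_bound :: "nat \<Rightarrow> nat \<Rightarrow> real \<Rightarrow> (fseq \<Rightarrow> real) \<Rightarrow> bool" where
  "pos_deriv_bound d k B f \<longleftrightarrow> (\<forall>vs. set vs \<subseteq> Rd d \<and> 1 \<le> length vs \<and> length vs \<le> k \<longrightarrow>
    (\<forall>x\<in>Rd d. \<bar>nabla d f vs x\<bar> \<le> B * prod_list (map norm vs)))"

lemma prod_norms_nonneg: "0 \<le> prod_list (map norm vs)"
  by (induction vs) auto

lemma deriv_bound_mono:
  assumes "deriv_bound d k w M f" "j \<le> k" "M \<le> M'" "\<And>x. 0 \<le> w x"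
  shows "deriv_bound d j w M' f"
  unfolding deriv_bound_def
proof (intro allI impI ballI)
  fix vs x assume "set vs \<subseteq> Rd d \<and> length vs \<le> j" "x \<in> Rd d"
  then have "\<bar>nabla d f vs x\<bar> \<le> M * prod_list (map norm vs) * w x"
    using assms(1,2) unfolding deriv_bound_def by auto
  also have "\<dots> \<le> M' * prod_list (map norm vs) * w x"
    by (intro mult_right_mono assms prod_norms_nonneg)
  finally show "\<bar>nabla d f vs x\<bar> \<le> M' * prod_list (map norm vs) * w x" .
qed

lemma deriv_bound_cong:
  assumes "\<And>x. x \<in> Rd d \<Longrightarrow> f x = g x" "deriv_bound d k w M f"
  shows "deriv_bound d k w M g"
  using assms(2) nabla_cong[of d f g, OF assms(1)] unfolding deriv_bound_def by simp

lemma deriv_bound_0: "deriv_bound d 0 w M f \<longleftrightarrow> (\<forall>x\<in>Rd d. \<bar>f x\<bar> \<le> M * w x)"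
  by (simp add: deriv_bound_def)

lemma deriv_bound_SucI:
  assumes "\<And>x. x \<in> Rd d \<Longrightarrow> \<bar>f x\<bar> \<le> M * w x"
    and "\<And>v. v \<in> Rd d \<Longrightarrow> deriv_bound d k w (M * norm v) (nabla d f [v])"
  shows "deriv_bound d (Suc k) w M f"
  unfolding deriv_bound_def
proof (intro allI impI ballI)
  fix vs x assume vs: "set vs \<subseteq> Rd d \<and> length vs \<le> Suc k" and x: "x \<in> Rd d"
  show "\<bar>nabla d f vs x\<bar> \<le> M * prod_list (map norm vs) * w x"
  proof (cases vs rule: rev_cases)
    case Nil
    then show ?thesis using assms(1)[OF x] by simp
  next
    case (snoc ws v)
    then have "\<bar>nabla d (nabla d f [v]) ws x\<bar> \<le> M * norm v * prod_list (map norm ws) * w x"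
      using assms(2)[of v] vs x unfolding deriv_bound_def by auto
    then show ?thesis
      using snoc by (simp add: nabla_append mult_ac del: nabla.simps)
  qed
qed

lemma deriv_bound_SucD:
  assumes f: "deriv_bound d (Suc k) w M f" and v: "v \<in> Rd d"
  shows "deriv_bound d k w (M * norm v) (nabla d f [v])"
  unfolding deriv_bound_def
proof (intro allI impI ballI)
  fix vs x assume "set vs \<subseteq> Rd d \<and> length vs \<le> k" and x: "x \<in> Rd d"
  then have "\<bar>nabla d f (vs @ [v]) x\<bar> \<le> M * prod_list (map norm (vs @ [v])) * w x"
    using f[unfolded deriv_bound_def, rule_format, of "vs @ [v]" x] v by auto
  then show "\<bar>nabla d (nabla d f [v]) vs x\<bar> \<le> M * norm v * prod_list (map norm vs) * w x"
    by (simp add: nabla_append mult_ac del: nabla.simps)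
qed

lemma pos_deriv_bound_Suc:
  "pos_deriv_bound d (Suc k) B f \<longleftrightarrow>
    (\<forall>v\<in>Rd d. deriv_bound d k (\<lambda>_. 1) (B * norm v) (nabla d f [v]))"
proof (intro iffI ballI)
  fix v assume f: "pos_deriv_bound d (Suc k) B f" and v: "v \<in> Rd d"
  show "deriv_bound d k (\<lambda>_. 1) (B * norm v) (nabla d f [v])"
    unfolding deriv_bound_def
  proof (intro allI impI ballI)
    fix vs x assume "set vs \<subseteq> Rd d \<and> length vs \<le> k" and x: "x \<in> Rd d"
    then have "\<bar>nabla d f (vs @ [v]) x\<bar> \<le> B * prod_list (map norm (vs @ [v]))"
      using f[unfolded pos_deriv_bound_def, rule_format, of "vs @ [v]" x] v by auto
    then show "\<bar>nabla d (nabla d f [v]) vs x\<bar> \<le> B * norm v * prod_list (map norm vs) * 1"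
      by (simp add: nabla_append mult_ac del: nabla.simps)
  qed
next
  assume f: "\<forall>v\<in>Rd d. deriv_bound d k (\<lambda>_. 1) (B * norm v) (nabla d f [v])"
  show "pos_deriv_bound d (Suc k) B f"
    unfolding pos_deriv_bound_def
  proof (intro allI impI ballI)
    fix vs x assume vs: "set vs \<subseteq> Rd d \<and> 1 \<le> length vs \<and> length vs \<le> Suc k" and x: "x \<in> Rd d"
    then obtain ws v where snoc: "vs = ws @ [v]"
      by (cases vs rule: rev_cases) auto
    have "\<bar>nabla d (nabla d f [v]) ws x\<bar> \<le> B * norm v * prod_list (map norm ws) * 1"
      using f vs x snoc unfolding deriv_bound_def by auto
    then show "\<bar>nabla d f vs x\<bar> \<le> B * prod_list (map norm vs)"
      using snoc by (simp add: nabla_append mult_ac del: nabla.simps)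
  qed
qed

lemma pos_deriv_bound_mono: "pos_deriv_bound d k B f \<Longrightarrow> j \<le> k \<Longrightarrow> pos_deriv_bound d j B f"
  by (simp add: pos_deriv_bound_def)

lemma deriv_bound_lincomb:
  assumes f: "times_differentiable d k f" "deriv_bound d k w M f"
    and g: "times_differentiable d k g" "deriv_bound d k w N g"
  shows "deriv_bound d k w (\<bar>a\<bar> * M + \<bar>b\<bar> * N) (\<lambda>x. a * f x + b * g x)"
  unfolding deriv_bound_def
proof (intro allI impI ballI)
  fix vs x assume vs: "set vs \<subseteq> Rd d \<and> length vs \<le> k" and x: "x \<in> Rd d"
  let ?P = "prod_list (map norm vs) * w x"
  have "\<bar>a * nabla d f vs x + b * nabla d g vs x\<bar> \<le> \<bar>a\<bar> * \<bar>nabla d f vs x\<bar> + \<bar>b\<bar> * \<bar>nabla d g vs x\<bar>"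
    by (metis abs_mult abs_triangle_ineq)
  also have "\<dots> \<le> \<bar>a\<bar> * (M * ?P) + \<bar>b\<bar> * (N * ?P)"
    using f(2) g(2) vs x unfolding deriv_bound_def mult.assoc by (intro add_mono mult_left_mono) auto
  finally show "\<bar>nabla d (\<lambda>x. a * f x + b * g x) vs x\<bar>
      \<le> (\<bar>a\<bar> * M + \<bar>b\<bar> * N) * prod_list (map norm vs) * w x"
    using vs x by (simp add: nabla_lincomb[OF f(1) g(1)] algebra_simps)
qed

text \<open>The Leibniz rule has \<open>2 ^ k\<close> terms; only the first factor carries the
  weight.\<close>

lemma deriv_bound_mult:
  assumes "0 \<le> M" "0 \<le> N" "\<And>x. 0 \<le> w x"
  shows "times_differentiable d k f \<Longrightarrow> deriv_bound d k w M f \<Longrightarrow>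
    times_differentiable d k g \<Longrightarrow> deriv_bound d k (\<lambda>_. 1) N g \<Longrightarrow>
    deriv_bound d k w (2 ^ k * M * N) (\<lambda>x. f x * g x)"
  using assms(1,2)
proof (induction k arbitrary: f g M N)
  case 0
  have "\<bar>f x * g x\<bar> \<le> M * N * w x" if "x \<in> Rd d" for x
  proof -
    have "\<bar>f x\<bar> * \<bar>g x\<bar> \<le> (M * w x) * (N * 1)"
      using 0 that assms(3) unfolding deriv_bound_0 by (intro mult_mono) auto
    then show ?thesis by (simp add: abs_mult mult_ac)
  qed
  then show ?case
    by (simp add: deriv_bound_0)
next
  case (Suc k)
  note f = times_differentiable_SucD[OF Suc.prems(1)] and g = times_differentiable_SucD[OF Suc.prems(3)]
  have fk: "times_differentiable d k f" "times_differentiable d k g"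
    by (rule times_differentiable_mono[OF Suc.prems(1)] times_differentiable_mono[OF Suc.prems(3)]; simp)+
  show ?case
  proof (rule deriv_bound_SucI)
    fix x assume x: "x \<in> Rd d"
    have "\<bar>f x\<bar> \<le> M * w x" "\<bar>g x\<bar> \<le> N"
      using Suc.prems(2,4)[unfolded deriv_bound_def, rule_format, of "[]" x] x by auto
    then have "\<bar>f x\<bar> * \<bar>g x\<bar> \<le> (M * w x) * N"
      using Suc.prems(5) assms(3) by (intro mult_mono) auto
    also have "\<dots> = 1 * (M * N * w x)" by simp
    also have "\<dots> \<le> 2 ^ Suc k * (M * N * w x)"
      using Suc.prems(5,6) assms(3) by (intro mult_right_mono one_le_power mult_nonneg_nonneg) auto
    finally show "\<bar>f x * g x\<bar> \<le> 2 ^ Suc k * M * N * w x"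
      by (simp add: abs_mult mult_ac)
  next
    fix v assume v: "v \<in> Rd d"
    have fb: "deriv_bound d k w M f" "deriv_bound d k (\<lambda>_. 1) N g"
      by (rule deriv_bound_mono[OF Suc.prems(2)]; simp add: assms(3))
        (rule deriv_bound_mono[OF Suc.prems(4)]; simp)
    have "deriv_bound d k w (\<bar>1\<bar> * (2 ^ k * (M * norm v) * N) + \<bar>1\<bar> * (2 ^ k * M * (N * norm v)))
        (\<lambda>x. 1 * (nabla d f [v] x * g x) + 1 * (f x * nabla d g [v] x))"
      by (intro deriv_bound_lincomb times_differentiable_mult Suc.IH fk f g v deriv_bound_SucD fb
          Suc.prems mult_nonneg_nonneg norm_ge_zero)
    then have "deriv_bound d k w (\<bar>1\<bar> * (2 ^ k * (M * norm v) * N) + \<bar>1\<bar> * (2 ^ k * M * (N * norm v)))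
        (nabla d (\<lambda>x. f x * g x) [v])"
      by (rule deriv_bound_cong[rotated]) (simp add: nabla_mult_single[OF f(1) g(1) _ v] del: nabla.simps)
    then show "deriv_bound d k w (2 ^ Suc k * M * N * norm v) (nabla d (\<lambda>x. f x * g x) [v])"
      by (simp add: algebra_simps del: nabla.simps)
  qed
qed

text \<open>Exactly one term of the Leibniz rule leaves \<open>f\<close> undifferentiated, and it is
  subtracted. Every other term contains a derivative of \<open>f\<close>, hence the weight, and
  differentiates \<open>g\<close> fewer than \<open>k\<close> times, so no bound on the top
  derivative of \<open>g\<close> enters.\<close>

lemma leibniz_remainder:
  assumes "0 \<le> M" "\<And>x. 0 \<le> w x" and f: "\<And>j v. j < k \<Longrightarrow> v \<in> Rd d \<Longrightarrow> deriv_bound d j w (M * norm v) (nabla d f [v])"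
  shows "times_differentiable d k f \<Longrightarrow> times_differentiable d k g \<Longrightarrow>
    (\<And>j. j < k \<Longrightarrow> deriv_bound d j (\<lambda>_. 1) N g) \<Longrightarrow> 0 \<le> N \<Longrightarrow>
    set vs \<subseteq> Rd d \<Longrightarrow> length vs = k \<Longrightarrow> x \<in> Rd d \<Longrightarrow>
    \<bar>nabla d (\<lambda>x. f x * g x) vs x - f x * nabla d g vs x\<bar> \<le> 2 ^ k * M * N * prod_list (map norm vs) * w x"
  using f
proof (induction k arbitrary: g N vs)
  case 0
  then show ?case using assms by simp
next
  case (Suc k)
  note f = times_differentiable_SucD[OF Suc.prems(1)] and g = times_differentiable_SucD[OF Suc.prems(2)]
  have fk: "times_differentiable d k f" "times_differentiable d k g"
    by (rule times_differentiable_mono[OF Suc.prems(1)] times_differentiable_mono[OF Suc.prems(2)]; simp)+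
  obtain ws v where snoc: "vs = ws @ [v]"
    using Suc.prems by (cases vs rule: rev_cases) auto
  have ws: "set ws \<subseteq> Rd d" "length ws = k" and v: "v \<in> Rd d"
    using snoc Suc.prems by auto
  have "nabla d (\<lambda>x. f x * g x) vs x = nabla d (nabla d (\<lambda>x. f x * g x) [v]) ws x"
    unfolding snoc nabla_append ..
  also have "\<dots> = nabla d (\<lambda>x. 1 * (nabla d f [v] x * g x) + 1 * (f x * nabla d g [v] x)) ws x"
    by (rule nabla_cong) (simp_all add: nabla_mult_single[OF f(1) g(1) _ v] Suc.prems del: nabla.simps)
  also have "\<dots> = 1 * nabla d (\<lambda>x. nabla d f [v] x * g x) ws x + 1 * nabla d (\<lambda>x. f x * nabla d g [v] x) ws x"
    by (rule nabla_lincomb[where k = k]) (auto intro!: times_differentiable_mult fk f g v Suc.prems ws simp: ws simp del: nabla.simps)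
  finally have 1: "nabla d (\<lambda>x. f x * g x) vs x - f x * nabla d g vs x =
      nabla d (\<lambda>x. nabla d f [v] x * g x) ws x +
      (nabla d (\<lambda>x. f x * nabla d g [v] x) ws x - f x * nabla d (nabla d g [v]) ws x)"
    unfolding snoc nabla_append by simp
  have "deriv_bound d k w (2 ^ k * (M * norm v) * N) (\<lambda>x. nabla d f [v] x * g x)"
    by (intro deriv_bound_mult f fk v Suc.prems assms mult_nonneg_nonneg norm_ge_zero lessI)
  then have 2: "\<bar>nabla d (\<lambda>x. nabla d f [v] x * g x) ws x\<bar> \<le>
      2 ^ k * (M * norm v) * N * prod_list (map norm ws) * w x"
    using ws Suc.prems(7) unfolding deriv_bound_def by blast
  have 3: "\<bar>nabla d (\<lambda>x. f x * nabla d g [v] x) ws x - f x * nabla d (nabla d g [v]) ws x\<bar> \<le>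
      2 ^ k * M * (N * norm v) * prod_list (map norm ws) * w x"
  proof (rule Suc.IH[OF fk(1) g(2)[OF v] deriv_bound_SucD[OF _ v] _ ws Suc.prems(7)])
    show "deriv_bound d (Suc j) (\<lambda>_. 1) N g" if "j < k" for j
      using Suc.prems(3) that by simp
    show "deriv_bound d j w (M * norm v) (nabla d f [v])" if "j < k" "v \<in> Rd d" for j v
      using Suc.prems(8) that by simp
  qed (simp add: Suc.prems(4))
  show ?case
    unfolding 1 using 2 3 by (simp add: snoc algebra_simps del: nabla.simps)
qed

section \<open>Chains of smooth maxima\<close>

lemma times_differentiable_const: "times_differentiable d k (\<lambda>_. a)"
proof (induction k arbitrary: a)
  case (Suc k)
  have "times_differentiable d k (nabla d (\<lambda>_. a) [v])" if "v \<in> Rd d" for v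
    by (rule times_differentiable_cong[OF _ Suc.IH[of 0]])
      (use nabla_singleI[OF has_derivative_const _ that] in simp)
  then show ?case
    by (simp add: times_differentiable_Suc del: nabla.simps)
qed (simp add: times_differentiable_0)

lemma times_differentiable_gam_plus:
  assumes "times_differentiable d k u" "k < j"
  shows "times_differentiable d k (\<lambda>x. gam_plus j (u x))"
  using assms
proof (induction k arbitrary: j)
  case (Suc k)
  obtain i where j: "j = Suc (Suc i)" "k < Suc i"
    using Suc.prems(2) by (cases j; cases "j - 1") auto
  note u = times_differentiable_SucD[OF Suc.prems(1)]
  have uk: "times_differentiable d k u"
    using Suc.prems(1) by (rule times_differentiable_mono) simp
  have "times_differentiable d k (nabla d (\<lambda>x. gam_plus j (u x)) [v])" if v: "v \<in> Rd d" for v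
  proof (rule times_differentiable_cong)
    show "times_differentiable d k (\<lambda>x. (1 * gam_plus (Suc i) (u x) + (-1) * gam_plus j (u x)) * nabla d u [v] x)"
      by (intro times_differentiable_mult times_differentiable_lincomb Suc.IH uk u v) (use j in auto)
  qed (simp add: nabla_comp_single[OF DERIV_gam_plus u(1) _ v] j del: nabla.simps)
  then show ?case
    unfolding times_differentiable_Suc j
    using differentiable_on_comp_real[OF DERIV_gam_plus u(1)] by blast
qed (simp add: times_differentiable_0)

lemma times_differentiable_gam_tail:
  assumes "times_differentiable d k u" "k \<le> Suc m"
  shows "times_differentiable d k (\<lambda>x. gam_tail (Suc (Suc m)) (u x))"
proof (cases k)
  case (Suc i)
  note u = times_differentiable_SucD[OF assms(1)[unfolded Suc]]
  have ui: "times_differentiable d i u"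
    using assms(1) by (rule times_differentiable_mono) (simp add: Suc)
  have "times_differentiable d i (nabla d (\<lambda>x. gam_tail (Suc (Suc m)) (u x)) [v])" if v: "v \<in> Rd d" for v
  proof (rule times_differentiable_cong)
    show "times_differentiable d i (\<lambda>x. (- 1 * gam_plus (Suc m) (u x) + 0 * u x) * nabla d u [v] x)"
      by (intro times_differentiable_mult times_differentiable_lincomb times_differentiable_gam_plus ui u v)
        (use assms(2) Suc in auto)
  qed (simp add: nabla_comp_single[OF DERIV_gam_tail u(1) _ v] del: nabla.simps)
  then show ?thesis
    unfolding times_differentiable_Suc Suc
    using differentiable_on_comp_real[OF DERIV_gam_tail u(1)] by blast
qed (simp add: times_differentiable_0)

text \<open>Differentiation produces the difference of two densities, of index \<open>j - 1\<close>
  and \<open>j\<close>, times a derivative of \<open>u\<close>; both densities are still dominated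
  by \<open>gam_tail n\<close>. The order of the quantifiers matters: \<open>K\<close> is chosen
  before the dimension and before \<open>u\<close>.\<close>

lemma deriv_bound_gam_plus:
  assumes "0 \<le> B"
  shows "\<exists>K\<ge>0. \<forall>d n j u. times_differentiable d k u \<and> pos_deriv_bound d k B u \<and> k < j \<and> j < n \<longrightarrow>
    deriv_bound d k (\<lambda>x. gam_tail n (u x)) K (\<lambda>x. gam_plus j (u x))"
proof (induction k)
  case 0
  show ?case
    by (rule exI[of _ 1]) (simp add: deriv_bound_0 gam_plus_le_gam_tail)
next
  case (Suc k)
  then obtain K where "0 \<le> K" and K: "\<And>d n j u. times_differentiable d k u \<Longrightarrow> pos_deriv_bound d k B u \<Longrightarrow>
    k < j \<Longrightarrow> j < n \<Longrightarrow> deriv_bound d k (\<lambda>x. gam_tail n (u x)) K (\<lambda>x. gam_plus j (u x))"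
    by blast
  \<comment> \<open>The 1 covers order 0. The other summand is the product bound for two densities,
    each with constant \<open>K\<close>, times a gradient bounded by \<open>B\<close>.\<close>
  let ?K = "1 + 2 ^ k * (2 * K) * B"
  have "deriv_bound d (Suc k) (\<lambda>x. gam_tail n (u x)) ?K (\<lambda>x. gam_plus j (u x))"
    if u': "times_differentiable d (Suc k) u" and b: "pos_deriv_bound d (Suc k) B u" and "Suc k < j" "j < n"
    for d n j u
  proof -
    obtain i where j: "j = Suc (Suc i)" "k < Suc i"
      using \<open>Suc k < j\<close> by (cases j; cases "j - 1") auto
    note u = times_differentiable_SucD[OF u']
    have uk: "times_differentiable d k u" "pos_deriv_bound d k B u"
      by (rule times_differentiable_mono[OF u'] pos_deriv_bound_mono[OF b]; simp)+
    show ?thesis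
    proof (rule deriv_bound_SucI)
      fix x
      have "\<bar>gam_plus j (u x)\<bar> \<le> 1 * gam_tail n (u x)"
        using gam_plus_le_gam_tail[OF \<open>j < n\<close>] by simp
      also have "\<dots> \<le> ?K * gam_tail n (u x)"
        using \<open>0 \<le> K\<close> \<open>0 \<le> B\<close> by (intro mult_right_mono gam_tail_nonneg) simp
      finally show "\<bar>gam_plus j (u x)\<bar> \<le> ?K * gam_tail n (u x)" .
    next
      fix v assume v: "v \<in> Rd d"
      have "deriv_bound d k (\<lambda>x. gam_tail n (u x)) (2 ^ k * (\<bar>1\<bar> * K + \<bar>-1\<bar> * K) * (B * norm v))
          (\<lambda>x. (1 * gam_plus (Suc i) (u x) + (-1) * gam_plus j (u x)) * nabla d u [v] x)"
        using b v \<open>0 \<le> K\<close> \<open>0 \<le> B\<close> j \<open>j < n\<close>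
        by (intro deriv_bound_mult deriv_bound_lincomb times_differentiable_lincomb
            times_differentiable_gam_plus K uk u(2)) (auto simp: gam_tail_nonneg pos_deriv_bound_Suc simp del: nabla.simps)
      then have "deriv_bound d k (\<lambda>x. gam_tail n (u x)) (2 ^ k * (\<bar>1\<bar> * K + \<bar>-1\<bar> * K) * (B * norm v))
          (nabla d (\<lambda>x. gam_plus j (u x)) [v])"
        by (rule deriv_bound_cong[rotated])
          (simp add: nabla_comp_single[OF DERIV_gam_plus u(1) _ v] j del: nabla.simps)
      then show "deriv_bound d k (\<lambda>x. gam_tail n (u x)) (?K * norm v) (nabla d (\<lambda>x. gam_plus j (u x)) [v])"
        by (rule deriv_bound_mono) (auto simp: gam_tail_nonneg algebra_simps)
    qed
  qed
  then show ?case
    using \<open>0 \<le> K\<close> \<open>0 \<le> B\<close> by (intro exI[of _ ?K]) auto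
qed

text \<open>
  One link of the chain: \<^term>\<open>y x + hinge n (z x - y x)\<close> is a smooth version of the maximum of
  \<open>y\<close> and \<open>z\<close>.
\<close>

lemma nabla_link:
  assumes y: "y differentiable_on Rd d" and z: "z differentiable_on Rd d" and x: "x \<in> Rd d" and v: "v \<in> Rd d"
  shows "nabla d (\<lambda>x. y x + hinge (Suc n) (z x - y x)) [v] x =
    nabla d z [v] x - gam_tail (Suc n) (z x - y x) * nabla d (\<lambda>x. z x - y x) [v] x"
    and "(\<lambda>x. y x + hinge (Suc n) (z x - y x)) differentiable_on Rd d"
    and "nabla d (\<lambda>x. z x - y x) [v] x = nabla d z [v] x - nabla d y [v] x"
proof -
  have d: "((\<lambda>x. z x - y x) has_derivative (\<lambda>v. nabla d z [v] x - nabla d y [v] x)) (at x within Rd d)"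
    if "x \<in> Rd d" for x
    by (intro has_derivative_diff nabla_single_has_derivative y z that)
  have l: "((\<lambda>x. y x + hinge (Suc n) (z x - y x)) has_derivative
      (\<lambda>v. nabla d y [v] x + (1 - gam_tail (Suc n) (z x - y x)) * (nabla d z [v] x - nabla d y [v] x))) (at x within Rd d)"
    if "x \<in> Rd d" for x
    by (intro has_derivative_add nabla_single_has_derivative y that has_derivative_comp_real[OF DERIV_hinge d])
  show E: "nabla d (\<lambda>x. z x - y x) [v] x = nabla d z [v] x - nabla d y [v] x"
    by (rule nabla_singleI[OF d]) (rule x v)+
  show "nabla d (\<lambda>x. y x + hinge (Suc n) (z x - y x)) [v] x =
    nabla d z [v] x - gam_tail (Suc n) (z x - y x) * nabla d (\<lambda>x. z x - y x) [v] x"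
    unfolding E using nabla_singleI[OF l x v] x by (simp add: algebra_simps del: nabla.simps)
  show "(\<lambda>x. y x + hinge (Suc n) (z x - y x)) differentiable_on Rd d"
    using l unfolding differentiable_on_def differentiable_def by blast
qed

lemma times_differentiable_link:
  assumes y: "times_differentiable d (Suc k) y" and z: "times_differentiable d (Suc k) z" and k: "k \<le> Suc m"
  shows "times_differentiable d (Suc k) (\<lambda>x. y x + hinge (Suc (Suc m)) (z x - y x))"
proof -
  note y1 = times_differentiable_SucD[OF y] and z1 = times_differentiable_SucD[OF z]
  have u: "times_differentiable d (Suc k) (\<lambda>x. z x - y x)"
    using times_differentiable_lincomb[OF z y, of 1 "-1"] by simp
  have "times_differentiable d k (nabla d (\<lambda>x. y x + hinge (Suc (Suc m)) (z x - y x)) [v])"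
    if v: "v \<in> Rd d" for v
  proof (rule times_differentiable_cong)
    show "times_differentiable d k (\<lambda>x. 1 * nabla d z [v] x + (-1) *
        (gam_tail (Suc (Suc m)) (z x - y x) * nabla d (\<lambda>x. z x - y x) [v] x))"
      by (intro times_differentiable_lincomb times_differentiable_mult times_differentiable_gam_tail z1
          times_differentiable_SucD[OF u] v k times_differentiable_mono[OF u]) simp
  qed (simp add: nabla_link(1)[OF y1(1) z1(1) _ v] del: nabla.simps)
  then show ?thesis
    unfolding times_differentiable_Suc using nabla_link(2)[OF y1(1) z1(1) Rd_0 Rd_0] by blast
qed

lemma pos_deriv_bound_diff:
  assumes "times_differentiable d k y" "times_differentiable d k z"
    and "pos_deriv_bound d k M y" "pos_deriv_bound d k N z"
  shows "pos_deriv_bound d k (N + M) (\<lambda>x. z x - y x)"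
  unfolding pos_deriv_bound_def
proof (intro allI impI ballI)
  fix vs x assume vs: "set vs \<subseteq> Rd d \<and> 1 \<le> length vs \<and> length vs \<le> k" and x: "x \<in> Rd d"
  have "nabla d (\<lambda>x. z x - y x) vs x = nabla d z vs x - nabla d y vs x"
    using nabla_lincomb[OF assms(2,1), of vs x 1 "-1"] vs x by simp
  moreover have "\<bar>nabla d z vs x\<bar> \<le> N * prod_list (map norm vs)" "\<bar>nabla d y vs x\<bar> \<le> M * prod_list (map norm vs)"
    using assms(3,4) vs x unfolding pos_deriv_bound_def by auto
  ultimately show "\<bar>nabla d (\<lambda>x. z x - y x) vs x\<bar> \<le> (N + M) * prod_list (map norm vs)"
    by (simp add: algebra_simps)
qed

text \<open>
  The top derivative of a link is \<open>(1 - Q) \<nabla>\<^sup>k z + Q \<nabla>\<^sup>k y\<close> up to an error \<open>K Q\<close>, where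
  \<open>Q\<close> is \<^const>\<open>gam_tail\<close>. Hence any bound \<open>B' \<ge> K\<close> for \<open>z\<close> is inherited by the link.
\<close>

lemma link_bound:
  assumes B: "0 \<le> B"
  shows "\<exists>K\<ge>0. \<forall>d m y z B'. k \<le> Suc m \<longrightarrow> times_differentiable d (Suc k) y \<longrightarrow> times_differentiable d (Suc k) z \<longrightarrow>
    pos_deriv_bound d (Suc k) 1 y \<longrightarrow> pos_deriv_bound d k B z \<longrightarrow> K \<le> B' \<longrightarrow> pos_deriv_bound d (Suc k) B' z \<longrightarrow>
    (\<forall>vs x. set vs \<subseteq> Rd d \<longrightarrow> length vs = Suc k \<longrightarrow> x \<in> Rd d \<longrightarrow>
      \<bar>nabla d (\<lambda>x. y x + hinge (Suc (Suc m)) (z x - y x)) vs x\<bar> \<le> B' * prod_list (map norm vs))"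
proof -
  have B1: "0 \<le> B + 1" using B by simp
  obtain K where "0 \<le> K" and K: "\<And>d n j u. times_differentiable d (k - 1) u \<Longrightarrow> pos_deriv_bound d (k - 1) (B + 1) u \<Longrightarrow>
    k - 1 < j \<Longrightarrow> j < n \<Longrightarrow> deriv_bound d (k - 1) (\<lambda>x. gam_tail n (u x)) K (\<lambda>x. gam_plus j (u x))"
    using deriv_bound_gam_plus[OF B1, of "k - 1"] by blast
  \<comment> \<open>Bounds the derivatives of \<open>Q\<close> of orders 1 to \<open>k\<close>
    relative to \<open>Q\<close> itself: the gradient of \<open>Q\<close> is a density at
    \<open>u x\<close> times the gradient of \<open>u\<close>, whose constant is
    \<open>B + 1\<close>.\<close>
  define M where "M = 2 ^ (k - 1) * K * (B + 1)"
  \<comment> \<open>The 1 is the bound on the top derivative of \<open>y\<close>, the other summand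
    is the Leibniz remainder; both will appear multiplied by \<open>Q\<close>.\<close>
  define K' where "K' = 1 + 2 ^ k * M * (B + 1)"
  have M: "0 \<le> M"
    using \<open>0 \<le> K\<close> B by (simp add: M_def)
  have "\<bar>nabla d (\<lambda>x. y x + hinge (Suc (Suc m)) (z x - y x)) vs x\<bar> \<le> B' * prod_list (map norm vs)"
    if k: "k \<le> Suc m" and y: "times_differentiable d (Suc k) y" and z: "times_differentiable d (Suc k) z"
      and yb: "pos_deriv_bound d (Suc k) 1 y" and zb: "pos_deriv_bound d k B z"
      and B': "K' \<le> B'" and zb': "pos_deriv_bound d (Suc k) B' z"
      and vs: "set vs \<subseteq> Rd d" "length vs = Suc k" and x: "x \<in> Rd d"
    for d m y z B' vs x
  proof -
    define u where "u = (\<lambda>x. z x - y x)"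
    define Q where "Q = (\<lambda>x. gam_tail (Suc (Suc m)) (u x))"
    define P where "P = prod_list (map norm vs)"
    note y1 = times_differentiable_SucD[OF y] and z1 = times_differentiable_SucD[OF z]
    have u: "times_differentiable d (Suc k) u"
      using times_differentiable_lincomb[OF z y, of 1 "-1"] by (simp add: u_def)
    have uk: "times_differentiable d k u" "times_differentiable d (k - 1) u"
      by (rule times_differentiable_mono[OF u]; simp)+
    have ub: "pos_deriv_bound d k (B + 1) u"
      unfolding u_def by (rule pos_deriv_bound_diff[OF times_differentiable_mono[OF y]
            times_differentiable_mono[OF z] pos_deriv_bound_mono[OF yb] zb]) simp_all
    note u1 = times_differentiable_SucD[OF u]
    have Qk: "times_differentiable d k Q"
      unfolding Q_def using uk(1) k by (rule times_differentiable_gam_tail)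
    have Q: "0 \<le> Q x" "Q x \<le> 1" for x
      by (simp_all add: Q_def gam_tail_nonneg gam_tail_le_1)
    obtain ws v where snoc: "vs = ws @ [v]"
      using vs by (cases vs rule: rev_cases) auto
    have ws: "set ws \<subseteq> Rd d" "length ws = k" and v: "v \<in> Rd d"
      using vs by (auto simp: snoc)
    have uvb: "deriv_bound d (k - 1) (\<lambda>_. 1) ((B + 1) * norm v) (nabla d u [v])" if "0 < k" "v \<in> Rd d" for v
      using ub that by (cases k) (auto simp: pos_deriv_bound_Suc simp del: nabla.simps)
    \<comment> \<open>The term split off contains the top derivative of \<open>z\<close>, which only
      \<open>B'\<close> controls. The remainder involves lower orders of \<open>u\<close> and is
      controlled by \<open>B\<close>.\<close>
    have "\<bar>nabla d (\<lambda>x. Q x * nabla d u [v] x) ws x - Q x * nabla d (nabla d u [v]) ws x\<bar> \<le>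
        2 ^ k * M * ((B + 1) * norm v) * prod_list (map norm ws) * Q x"
    proof (rule leibniz_remainder[OF M])
      fix j v assume j: "j < k" and v: "v \<in> Rd d"
      have td: "times_differentiable d (k - 1) (nabla d u [v])"
        using u1(2)[OF v] by (rule times_differentiable_mono) simp
      have "deriv_bound d (k - 1) Q (2 ^ (k - 1) * (\<bar>-1\<bar> * K + \<bar>0\<bar> * K) * ((B + 1) * norm v))
          (\<lambda>x. (-1 * gam_plus (Suc m) (u x) + 0 * gam_plus (Suc m) (u x)) * nabla d u [v] x)"
        unfolding Q_def using \<open>0 \<le> K\<close> B j k v
        by (intro deriv_bound_mult deriv_bound_lincomb times_differentiable_lincomb td uvb
            times_differentiable_gam_plus K uk pos_deriv_bound_mono[OF ub]) (auto simp: gam_tail_nonneg)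
      then have "deriv_bound d (k - 1) Q (2 ^ (k - 1) * (\<bar>-1\<bar> * K + \<bar>0\<bar> * K) * ((B + 1) * norm v)) (nabla d Q [v])"
        by (rule deriv_bound_cong[rotated])
          (simp add: Q_def nabla_comp_single[OF DERIV_gam_tail u1(1) _ v] del: nabla.simps)
      then show "deriv_bound d j Q (M * norm v) (nabla d Q [v])"
        by (rule deriv_bound_mono) (use j in \<open>auto simp: Q M_def mult_ac\<close>)
    next
      fix j assume j: "j < k"
      show "deriv_bound d j (\<lambda>_. 1) ((B + 1) * norm v) (nabla d u [v])"
        by (rule deriv_bound_mono[OF uvb]) (use j v in auto)
    qed (use B in \<open>auto intro!: Q Qk u1 v ws x simp: ws simp del: nabla.simps\<close>)
    also have "2 ^ k * M * ((B + 1) * norm v) * prod_list (map norm ws) * Q x = (K' - 1) * P * Q x"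
      by (simp add: K'_def P_def snoc mult_ac)
    finally have R: "\<bar>nabla d (\<lambda>x. Q x * nabla d u [v] x) ws x - Q x * nabla d u vs x\<bar> \<le> (K' - 1) * P * Q x"
      unfolding snoc nabla_append .
    have "nabla d (\<lambda>x. y x + hinge (Suc (Suc m)) (z x - y x)) vs x =
        nabla d (\<lambda>x. 1 * nabla d z [v] x + (-1) * (Q x * nabla d u [v] x)) ws x"
      unfolding snoc nabla_append
      by (rule nabla_cong) (simp_all add: nabla_link(1)[OF y1(1) z1(1) _ v] Q_def u_def x del: nabla.simps)
    also have "\<dots> = 1 * nabla d (nabla d z [v]) ws x + (-1) * nabla d (\<lambda>x. Q x * nabla d u [v] x) ws x"
      by (rule nabla_lincomb[where k = k]) (auto intro!: z1 times_differentiable_mult Qk u1 v ws x simp: ws simp del: nabla.simps)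
    finally have 1: "nabla d (\<lambda>x. y x + hinge (Suc (Suc m)) (z x - y x)) vs x =
        nabla d z vs x - nabla d (\<lambda>x. Q x * nabla d u [v] x) ws x"
      unfolding snoc nabla_append by simp
    have 2: "nabla d u vs x = nabla d z vs x - nabla d y vs x"
      using nabla_lincomb[OF z y, of vs x 1 "-1"] vs x by (simp add: u_def)
    have 3: "\<bar>(1 - Q x) * nabla d z vs x\<bar> \<le> (1 - Q x) * (B' * P)"
      using zb' vs x Q(2)[of x] unfolding pos_deriv_bound_def P_def abs_mult by (intro mult_mono) auto
    have 4: "\<bar>Q x * nabla d y vs x\<bar> \<le> Q x * (1 * P)"
      using yb vs x Q(1)[of x] unfolding pos_deriv_bound_def P_def abs_mult by (intro mult_mono) auto
    have "\<bar>nabla d (\<lambda>x. y x + hinge (Suc (Suc m)) (z x - y x)) vs x\<bar> \<le>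
        (1 - Q x) * (B' * P) + Q x * (1 * P) + (K' - 1) * P * Q x"
      using R 3 4 unfolding 1 2 by (simp add: algebra_simps) 
    \<comment> \<open>The bound is the convex combination of \<open>B'\<close> and \<open>K'\<close>
      with weights \<open>1 - Q x\<close> and \<open>Q x\<close>, times \<open>P\<close>. Since
      \<open>K' \<le> B'\<close>, the constant does not grow from one link to the next.\<close>
    also have "\<dots> = B' * P - (B' - K') * (P * Q x)"
      by (simp add: algebra_simps)
    also have "\<dots> \<le> B' * P"
      using B' Q(1)[of x] prod_norms_nonneg[of vs] by (simp add: P_def)
    finally show ?thesis
      by (simp add: P_def)
  qed
  moreover have "0 \<le> K'"
    using M B by (simp add: K'_def)
  ultimately show ?thesis
    by (intro exI[of _ K']) blast
qed

section \<open>Affine links, and derivative bounds for chains\<close>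

lemma abs_coord_le_norm: "\<bar>coord x i\<bar> \<le> norm x"
proof (cases "coord x i = 0")
  case False
  have "(coord x i)\<^sup>2 \<le> inner x x"
    unfolding inner_fseq_def power2_eq_square
    by (rule member_le_sum[of i _ "\<lambda>i. coord x i * coord x i"]) (use False in auto)
  then show ?thesis
    by (simp add: norm_eq_sqrt_inner real_le_rsqrt)
qed simp

lemma bounded_linear_coord: "bounded_linear (\<lambda>x. coord x i)"
  by (rule bounded_linear_intro[where K = 1]) (auto simp: abs_coord_le_norm)

text \<open>A link is encoded as a pair of a coordinate index and a sign; \<open>c\<close> is its
  position in the chain.\<close>

definition affine_form :: "nat \<Rightarrow> nat \<times> real \<Rightarrow> fseq \<Rightarrow> real" where
  "affine_form c e x = snd e * coord x (fst e) - real c"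

lemma affine_form_has_derivative:
  "(affine_form c e has_derivative (\<lambda>v. snd e * coord v (fst e))) (at x within S)"
  unfolding affine_form_def[abs_def]
  by (auto intro!: derivative_eq_intros bounded_linear.has_derivative[OF bounded_linear_coord])

lemma nabla_affine_form:
  "x \<in> Rd d \<Longrightarrow> v \<in> Rd d \<Longrightarrow> nabla d (affine_form c e) [v] x = snd e * coord v (fst e)"
  by (rule nabla_singleI[OF affine_form_has_derivative])

lemma times_differentiable_affine_form: "times_differentiable d k (affine_form c e)"
proof (cases k)
  case (Suc i)
  have "times_differentiable d i (nabla d (affine_form c e) [v])" if "v \<in> Rd d" for v
    by (rule times_differentiable_cong[OF _ times_differentiable_const])
      (rule nabla_affine_form[OF _ that, symmetric])
  then show ?thesis
    using affine_form_has_derivative unfolding Suc times_differentiable_Suc differentiable_on_def differentiable_def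
    by blast
qed (simp add: times_differentiable_0)

lemma deriv_bound_const: "\<bar>a\<bar> \<le> M \<Longrightarrow> deriv_bound d k (\<lambda>_. 1) M (\<lambda>_. a)"
proof (induction k arbitrary: a M)
  case (Suc k)
  show ?case
  proof (rule deriv_bound_SucI)
    fix v assume v: "v \<in> Rd d"
    show "deriv_bound d k (\<lambda>_. 1) (M * norm v) (nabla d (\<lambda>_. a) [v])"
    proof (rule deriv_bound_cong)
      show "deriv_bound d k (\<lambda>_. 1) (M * norm v) (\<lambda>_. 0)"
        using Suc.prems by (intro Suc.IH) simp
    qed (use nabla_singleI[OF has_derivative_const _ v] in simp)
  qed (use Suc.prems in simp)
qed (simp add: deriv_bound_0)

lemma pos_deriv_bound_affine_form:
  assumes "\<bar>snd e\<bar> \<le> 1"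
  shows "pos_deriv_bound d k 1 (affine_form c e)"
proof -
  have "deriv_bound d k (\<lambda>_. 1) (1 * norm v) (nabla d (affine_form c e) [v])" if v: "v \<in> Rd d" for v
  proof (rule deriv_bound_cong[OF _ deriv_bound_const])
    show "snd e * coord v (fst e) = nabla d (affine_form c e) [v] x" if "x \<in> Rd d" for x
      using nabla_affine_form[OF that v] by simp
    show "\<bar>snd e * coord v (fst e)\<bar> \<le> 1 * norm v"
      unfolding abs_mult by (intro mult_mono assms abs_coord_le_norm) auto
  qed
  then have "pos_deriv_bound d (Suc k) 1 (affine_form c e)"
    unfolding pos_deriv_bound_Suc by blast
  then show ?thesis
    by (rule pos_deriv_bound_mono) simp
qed

text \<open>The last link is the bare affine form, so the default value 0 of the empty chain never
  enters a longer one. The counter \<open>c\<close> shifts each link one below its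
  predecessor.\<close>

primrec chain :: "nat \<Rightarrow> nat \<Rightarrow> (nat \<times> real) list \<Rightarrow> fseq \<Rightarrow> real" where
  "chain n c [] = (\<lambda>_. 0)"
| "chain n c (e # L) = (if L = [] then affine_form c e
    else (\<lambda>x. affine_form c e x + hinge n (chain n (Suc c) L x - affine_form c e x)))"

lemma times_differentiable_chain:
  assumes "k \<le> Suc m"
  shows "times_differentiable d (Suc k) (chain (Suc (Suc m)) c L)"
  by (induction L arbitrary: c)
    (auto intro!: times_differentiable_const times_differentiable_affine_form times_differentiable_link assms)

lemma pos_deriv_bound_weaken:
  "pos_deriv_bound d k M f \<Longrightarrow> M \<le> N \<Longrightarrow> pos_deriv_bound d k N f"
  unfolding pos_deriv_bound_def by (meson mult_right_mono order_trans prod_norms_nonneg)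

text \<open>\<open>B\<close> is chosen before the dimension and the list, hence is uniform in both.
  The outer induction is on the order: the bound for order \<open>k\<close> feeds
  \<open>link_bound\<close>, and an inner induction on the list carries the bound for order
  \<open>k + 1\<close> from link to link.\<close>

theorem chain_deriv_bound:
  "\<exists>B\<ge>0. \<forall>d m c L. k \<le> Suc (Suc m) \<longrightarrow> (\<forall>e\<in>set L. \<bar>snd e\<bar> \<le> 1) \<longrightarrow>
    pos_deriv_bound d k B (chain (Suc (Suc m)) c L)"
proof (induction k)
  case 0
  show ?case
    by (rule exI[of _ 0]) (simp add: pos_deriv_bound_def)
next
  case (Suc k)
  then obtain B where B: "0 \<le> B" "\<And>d m c L. k \<le> Suc (Suc m) \<Longrightarrow> \<forall>e\<in>set L. \<bar>snd e\<bar> \<le> 1 \<Longrightarrow>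
    pos_deriv_bound d k B (chain (Suc (Suc m)) c L)"
    by blast
  obtain K where K: "0 \<le> K" "\<And>d m y z B' vs x. k \<le> Suc m \<Longrightarrow> times_differentiable d (Suc k) y \<Longrightarrow>
    times_differentiable d (Suc k) z \<Longrightarrow> pos_deriv_bound d (Suc k) 1 y \<Longrightarrow> pos_deriv_bound d k B z \<Longrightarrow> K \<le> B' \<Longrightarrow>
    pos_deriv_bound d (Suc k) B' z \<Longrightarrow> set vs \<subseteq> Rd d \<Longrightarrow> length vs = Suc k \<Longrightarrow> x \<in> Rd d \<Longrightarrow>
      \<bar>nabla d (\<lambda>x. y x + hinge (Suc (Suc m)) (z x - y x)) vs x\<bar> \<le> B' * prod_list (map norm vs)"
    using link_bound[OF B(1), of k] by blast
  \<comment> \<open>\<open>B\<close> covers the lower orders, \<open>K\<close> makes the bound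
    survive a link, and 1 is the bound of the final affine form.\<close>
  define B' where "B' = max (max B K) 1"
  have B': "B \<le> B'" "K \<le> B'" "1 \<le> B'"
    by (auto simp: B'_def)
  have "pos_deriv_bound d (Suc k) B' (chain (Suc (Suc m)) c L)"
    if k: "Suc k \<le> Suc (Suc m)" and L: "\<forall>e\<in>set L. \<bar>snd e\<bar> \<le> 1" for d m c L
    using L
  proof (induction L arbitrary: c)
    case Nil
    have "deriv_bound d (Suc k) (\<lambda>_. 1) B' (\<lambda>_. 0)"
      using B' by (intro deriv_bound_const) simp
    then show ?case
      by (simp add: deriv_bound_def pos_deriv_bound_def)
  next
    case (Cons e L)
    have e: "pos_deriv_bound d (Suc k) 1 (affine_form c e)"
      using Cons.prems by (intro pos_deriv_bound_affine_form) auto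
    show ?case
    proof (cases "L = []")
      case True
      then show ?thesis
        using pos_deriv_bound_weaken[OF e B'(3)] by simp
    next
      case False
      show ?thesis
        unfolding pos_deriv_bound_def
      proof (intro allI impI ballI)
        fix vs x assume vs: "set vs \<subseteq> Rd d \<and> 1 \<le> length vs \<and> length vs \<le> Suc k" and x: "x \<in> Rd d"
        show "\<bar>nabla d (chain (Suc (Suc m)) c (e # L)) vs x\<bar> \<le> B' * prod_list (map norm vs)"
        proof (cases "length vs = Suc k")
          case True
          have "\<bar>nabla d (\<lambda>x. affine_form c e x +
              hinge (Suc (Suc m)) (chain (Suc (Suc m)) (Suc c) L x - affine_form c e x)) vs x\<bar>
              \<le> B' * prod_list (map norm vs)"
            using k True vs x B'(2) Cons.prems
            by (intro K times_differentiable_affine_form times_differentiable_chain e B(2) Cons.IH) auto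
          then show ?thesis
            using False by simp
        next
          case False
          have "pos_deriv_bound d k B (chain (Suc (Suc m)) c (e # L))"
            using k Cons.prems by (intro B(2)) auto
          then have "pos_deriv_bound d k B' (chain (Suc (Suc m)) c (e # L))"
            using B'(1) by (rule pos_deriv_bound_weaken)
          then show ?thesis
            using False vs x unfolding pos_deriv_bound_def by auto
        qed
      qed
    qed
  qed
  then show ?case
    using B(1) B'(1) by (intro exI[of _ B']) auto
qed

section \<open>Values and convexity of chains\<close>

text \<open>By \<open>hinge_le\<close> a link never exceeds the true maximum of its two arguments,
  and the shifts only lower the later ones.\<close>

lemma chain_le:
  assumes "\<forall>e\<in>set L. snd e * coord x (fst e) \<le> a" "L \<noteq> []"
  shows "chain (Suc n) c L x \<le> a - real c"
  using assms
proof (induction L arbitrary: c)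
  case (Cons e L)
  show ?case
  proof (cases "L = []")
    case False
    have "chain (Suc n) (Suc c) L x \<le> a - real (Suc c)"
      by (rule Cons.IH) (use Cons.prems False in auto)
    moreover have "affine_form c e x \<le> a - real c"
      using Cons.prems by (simp add: affine_form_def)
    moreover have "hinge (Suc n) (chain (Suc n) (Suc c) L x - affine_form c e x)
        \<le> max 0 (chain (Suc n) (Suc c) L x - affine_form c e x)"
      by (rule hinge_le)
    ultimately show ?thesis
      using False by (simp add: max_def split: if_splits)
  qed (use Cons.prems in \<open>simp add: affine_form_def\<close>)
qed simp

text \<open>Each step away from the last link costs at most \<open>Suc n\<close>: \<open>n\<close>
  through \<open>hinge_ge\<close> and 1 through the shift.\<close>

lemma chain_ge_last:
  assumes "L \<noteq> []"
  shows "snd (last L) * coord x (fst (last L)) - real c - real (Suc n) * (real (length L) - 1) \<le> chain n c L x"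
  using assms
proof (induction L arbitrary: c)
  case (Cons e L)
  show ?case
  proof (cases "L = []")
    case False
    have "snd (last L) * coord x (fst (last L)) - real (Suc c) - real (Suc n) * (real (length L) - 1)
        \<le> chain n (Suc c) L x"
      using Cons.IH False by blast
    moreover have "chain n (Suc c) L x - affine_form c e x - real n
        \<le> hinge n (chain n (Suc c) L x - affine_form c e x)"
      by (rule hinge_ge)
    ultimately show ?thesis
      using False by (simp add: algebra_simps)
  qed (simp add: affine_form_def)
qed simp

lemma chain_ge_hd: "affine_form c e x \<le> chain (Suc n) c (e # L) x"
  by (simp add: hinge_nonneg)

text \<open>The slack of \<open>1\<close>, gained from the shifts of the later links, makes this a local statement.\<close>

lemma chain_prefix:
  assumes "\<forall>e'\<in>set L2. snd e' * coord x (fst e') \<le> snd e * coord x (fst e) + 1"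
  shows "chain (Suc n) c (L1 @ e # L2) x = chain (Suc n) c (L1 @ [e]) x"
proof (induction L1 arbitrary: c)
  case Nil
  show ?case
  proof (cases "L2 = []")
    case False
    then have "chain (Suc n) (Suc c) L2 x \<le> snd e * coord x (fst e) + 1 - real (Suc c)"
      using assms by (intro chain_le)
    then show ?thesis
      using False by (simp add: affine_form_def hinge_nonpos_arg)
  qed simp
qed simp

lemma convex_Rd: "convex (Rd d)"
  by (rule subspace_imp_convex[OF subspace_Rd])

text \<open>Since \<open>?y\<close> is affine, \<open>?z - ?y\<close> is convex, and a monotone
  convex function of it remains convex.\<close>

lemma convex_on_chain: "convex_on (Rd d) (chain (Suc (Suc m)) c L)"
proof (induction L arbitrary: c)
  case Nil
  then show ?case by (simp add: convex_on_const convex_Rd)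
next
  case (Cons e L)
  let ?y = "affine_form c e" and ?z = "chain (Suc (Suc m)) (Suc c) L" and ?h = "hinge (Suc (Suc m))"
  have y: "?y ((1 - t) *\<^sub>R x + t *\<^sub>R x') = (1 - t) * ?y x + t * ?y x'" for t x x'
    by (simp add: affine_form_def algebra_simps)
  show ?case
  proof (cases "L = []")
    case True
    then show ?thesis
      by (auto intro!: convex_onI convex_Rd simp: y)
  next
    case False
    have "convex_on (Rd d) (\<lambda>x. ?y x + ?h (?z x - ?y x))"
    proof (rule convex_onI[OF _ convex_Rd])
      fix t x x' assume t: "0 < t" "t < (1 :: real)" and x: "x \<in> Rd d" "x' \<in> Rd d"
      define p where "p = (1 - t) *\<^sub>R x + t *\<^sub>R x'"
      have yp: "?y p = (1 - t) * ?y x + t * ?y x'"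
        unfolding p_def by (rule y)
      have "?z p \<le> (1 - t) * ?z x + t * ?z x'"
        using convex_onD[OF Cons.IH, of t x x'] t x by (simp add: p_def)
      then have "?h (?z p - ?y p) \<le> ?h ((1 - t) *\<^sub>R (?z x - ?y x) + t *\<^sub>R (?z x' - ?y x'))"
        by (intro hinge_mono) (simp add: yp algebra_simps)
      also have "\<dots> \<le> (1 - t) * ?h (?z x - ?y x) + t * ?h (?z x' - ?y x')"
        using convex_onD[OF convex_hinge[of m], of t] t by simp
      finally have "?y p + ?h (?z p - ?y p) \<le> (1 - t) * (?y x + ?h (?z x - ?y x)) + t * (?y x' + ?h (?z x' - ?y x'))"
        by (simp add: yp algebra_simps)
      then show "?y ((1 - t) *\<^sub>R x + t *\<^sub>R x') + ?h (?z ((1 - t) *\<^sub>R x + t *\<^sub>R x') - ?y ((1 - t) *\<^sub>R x + t *\<^sub>R x'))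
          \<le> (1 - t) * (?y x + ?h (?z x - ?y x)) + t * (?y x' + ?h (?z x' - ?y x'))"
        by (simp only: p_def)
    qed
    then show ?thesis
      using False by simp
  qed
qed

section \<open>Rescaling and Hoelder smoothness\<close>

lemma nabla_scale:
  assumes g: "times_differentiable d k g"
  shows "set vs \<subseteq> Rd d \<Longrightarrow> length vs \<le> k \<Longrightarrow> x \<in> Rd d \<Longrightarrow>
    nabla d (\<lambda>x. g (b *\<^sub>R x)) vs x = b ^ length vs * nabla d g vs (b *\<^sub>R x)"
proof (induction vs arbitrary: x)
  case (Cons v vs)
  have "nabla d g vs differentiable_on Rd d"
    using g Cons.prems by (auto simp: times_differentiable_def)
  then have D: "(nabla d g vs has_derivative (\<lambda>v. nabla d g (v # vs) (b *\<^sub>R x))) (at (b *\<^sub>R x) within Rd d)"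
    by (rule nabla_has_derivative) (simp add: Rd_scale Cons.prems)
  have "((\<lambda>x. nabla d g vs (b *\<^sub>R x)) has_derivative (\<lambda>v. nabla d g ((b *\<^sub>R v) # vs) (b *\<^sub>R x))) (at x within Rd d)"
    by (rule has_derivative_in_compose[where f = "\<lambda>x. b *\<^sub>R x" and f' = "\<lambda>x. b *\<^sub>R x"])
      (auto intro!: derivative_eq_intros has_derivative_subset[OF D] Rd_scale simp del: nabla.simps)
  then have "((\<lambda>x. b ^ length vs * nabla d g vs (b *\<^sub>R x)) has_derivative
      (\<lambda>v. b ^ length vs * nabla d g ((b *\<^sub>R v) # vs) (b *\<^sub>R x))) (at x within Rd d)"
    by (rule has_derivative_mult_right)
  then have "(nabla d (\<lambda>x. g (b *\<^sub>R x)) vs has_derivative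
      (\<lambda>v. b ^ length vs * nabla d g ((b *\<^sub>R v) # vs) (b *\<^sub>R x))) (at x within Rd d)"
    by (rule nabla_Cons_cong[rotated]) (use Cons in auto)
  then have "nabla d (\<lambda>x. g (b *\<^sub>R x)) (v # vs) x = b ^ length vs * nabla d g ((b *\<^sub>R v) # vs) (b *\<^sub>R x)"
    using Cons.prems by (intro nabla_ConsI) auto
  also have "nabla d g ((b *\<^sub>R v) # vs) (b *\<^sub>R x) = b * nabla d g (v # vs) (b *\<^sub>R x)"
    using linear_cmul[OF has_derivative_linear[OF D]] by simp
  finally show ?case
    by (simp del: nabla.simps)
qed simp

lemma times_differentiable_scale:
  assumes g: "times_differentiable d k g"
  shows "times_differentiable d k (\<lambda>x. g (b *\<^sub>R x))"
  unfolding times_differentiable_def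
proof (intro allI impI)
  fix vs assume vs: "set vs \<subseteq> Rd d \<and> length vs < k"
  have "nabla d g vs differentiable_on Rd d"
    using g vs by (auto simp: times_differentiable_def)
  then have D: "(nabla d g vs has_derivative (\<lambda>v. nabla d g (v # vs) (b *\<^sub>R x))) (at (b *\<^sub>R x) within Rd d)"
    if "x \<in> Rd d" for x
    by (rule nabla_has_derivative) (simp add: Rd_scale that)
  have "((\<lambda>x. nabla d g vs (b *\<^sub>R x)) has_derivative (\<lambda>v. nabla d g ((b *\<^sub>R v) # vs) (b *\<^sub>R x))) (at x within Rd d)"
    if "x \<in> Rd d" for x
    by (rule has_derivative_in_compose[where f = "\<lambda>x. b *\<^sub>R x" and f' = "\<lambda>x. b *\<^sub>R x"])
      (auto intro!: derivative_eq_intros has_derivative_subset[OF D] Rd_scale that simp del: nabla.simps)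
  then have "(\<lambda>x. b ^ length vs * nabla d g vs (b *\<^sub>R x)) differentiable_on Rd d"
    unfolding differentiable_on_def differentiable_def using has_derivative_mult_right by blast
  then show "nabla d (\<lambda>x. g (b *\<^sub>R x)) vs differentiable_on Rd d"
    by (rule differentiable_on_cong[rotated]) (use vs in \<open>auto simp: nabla_scale[OF g]\<close>)
qed

lemma nabla_increment_le:
  assumes "nabla d f vs differentiable_on Rd d" "x \<in> Rd d" "y \<in> Rd d"
    and M: "\<And>z. z \<in> Rd d \<Longrightarrow> \<bar>nabla d f ((x - y) # vs) z\<bar> \<le> M"
  shows "\<bar>nabla d f vs x - nabla d f vs y\<bar> \<le> M"
proof -
  let ?g = "\<lambda>t. nabla d f vs (y + t *\<^sub>R (x - y))"
  have *: "y + t *\<^sub>R (x - y) \<in> Rd d" for t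
    by (intro Rd_add Rd_scale Rd_diff assms)
  have D: "(?g has_real_derivative nabla d f ((x - y) # vs) (y + t *\<^sub>R (x - y))) (at t)" for t
    by (rule has_real_derivative_line[where D = "\<lambda>v. nabla d f (v # vs) (y + t *\<^sub>R (x - y))"])
      (rule nabla_has_derivative Rd_diff assms *)+
  obtain t :: real where "?g 1 - ?g 0 = (1 - 0) * nabla d f ((x - y) # vs) (y + t *\<^sub>R (x - y))"
    using MVT2[of 0 1 ?g, OF _ D] by force
  then show ?thesis
    using M[OF *[of t]] by simp
qed

lemma tensor_norm_le:
  assumes "\<And>vs. length vs = k \<Longrightarrow> set vs \<subseteq> Rd d \<Longrightarrow> \<forall>v\<in>set vs. norm v \<le> 1 \<Longrightarrow> \<bar>A vs\<bar> \<le> M"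
  shows "tensor_norm d k A \<le> M"
  unfolding tensor_norm_def
proof (rule cSUP_least)
  \<comment> \<open>A supremum of reals is bounded by its upper bounds only over a nonempty index
    set; the zero directions provide an element.\<close>
  have "replicate k 0 \<in> {vs. length vs = k \<and> (\<forall>v\<in>set vs. v \<in> Rd d \<and> norm v \<le> 1)}"
    by (simp add: Rd_0)
  then show "{vs. length vs = k \<and> (\<forall>v\<in>set vs. v \<in> Rd d \<and> norm v \<le> 1)} \<noteq> {}"
    by blast
qed (use assms in auto)

text \<open>Interpolates between boundedness and Lipschitz continuity, which yields every Hoelder
  degree up to 1.\<close>

lemma min_le_powr:
  fixes t \<nu> :: real
  assumes "0 < \<nu>" "\<nu> \<le> 1" "0 \<le> t"
  shows "min 2 t \<le> 2 * t powr \<nu>"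
proof (cases "t \<le> 1")
  case True
  have "t powr 1 \<le> t powr \<nu>"
    using assms True powr_mono'[of \<nu> 1 t] by simp
  then show ?thesis
    using assms by (simp add: min_def)
next
  case False
  then have "1 \<le> t powr \<nu>"
    using assms by (simp add: ge_one_powr_ge_zero)
  then show ?thesis by simp
qed

text \<open>The derivatives of order \<open>p\<close> are bounded and, by the bound of order
  \<open>p + 1\<close>, Lipschitz. With \<open>?t = b * norm (x - y)\<close> their increments are at
  most \<open>a * b ^ p * B * min 2 ?t\<close>, and \<open>min_le_powr\<close> supplies the exponent
  \<nu>.\<close>

lemma holder_smooth_scale:
  assumes g: "times_differentiable d (Suc p) g" "pos_deriv_bound d (Suc p) B g" and p: "1 \<le> p"
    and \<nu>: "0 < \<nu>" "\<nu> \<le> 1" and a: "0 \<le> a" and b: "0 < b" and B: "0 \<le> B"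
  shows "holder_smooth d p \<nu> (2 * a * B * b powr (real p + \<nu>)) (\<lambda>x. a * g (b *\<^sub>R x))"
proof -
  let ?f = "\<lambda>x. a * g (b *\<^sub>R x)"
  have s: "times_differentiable d (Suc p) (\<lambda>x. g (b *\<^sub>R x))"
    by (rule times_differentiable_scale[OF g(1)])
  have f: "times_differentiable d (Suc p) ?f"
    using times_differentiable_lincomb[OF s s, of a 0] by simp
  have nf: "nabla d ?f vs x = a * b ^ length vs * nabla d g vs (b *\<^sub>R x)"
    if "set vs \<subseteq> Rd d" "length vs \<le> Suc p" "x \<in> Rd d" for vs x
    using nabla_lincomb[OF s s that, of a 0] nabla_scale[OF g(1) that] by simp
  have bound: "\<bar>nabla d ?f vs x\<bar> \<le> a * b ^ length vs * (B * prod_list (map norm vs))"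
    if "set vs \<subseteq> Rd d" "length vs \<le> Suc p" "1 \<le> length vs" "x \<in> Rd d" for vs x
  proof -
    have "\<bar>nabla d g vs (b *\<^sub>R x)\<bar> \<le> B * prod_list (map norm vs)"
      using g(2) that Rd_scale[of x d b] unfolding pos_deriv_bound_def by auto
    then show ?thesis
      using a b nf[OF that(1,2,4)] by (simp add: abs_mult mult_left_mono)
  qed
  have "tensor_norm d p (\<lambda>vs. nabla d ?f vs x - nabla d ?f vs y) \<le> 2 * a * B * b powr (real p + \<nu>) * norm (x - y) powr \<nu>"
    if x: "x \<in> Rd d" and y: "y \<in> Rd d" for x y
  proof (rule tensor_norm_le)
    fix vs assume vs: "length vs = p" "set vs \<subseteq> Rd d" and le1: "\<forall>v\<in>set vs. norm v \<le> 1"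
    let ?P = "prod_list (map norm vs)" and ?t = "b * norm (x - y)"
    have P: "?P \<le> 1"
      using le1 by (induction vs) (auto intro!: mult_le_one prod_norms_nonneg)
    have C: "0 \<le> a * b ^ p * B"
      using a b B by simp
    have bp: "\<bar>nabla d ?f vs z\<bar> \<le> a * b ^ p * B" if "z \<in> Rd d" for z
      using bound[OF vs(2) _ _ that] vs(1) p mult_left_mono[OF P C] by (simp add: mult.assoc)
    have "\<bar>nabla d ?f vs x - nabla d ?f vs y\<bar> \<le> a * b ^ p * B * ?t"
    proof (rule nabla_increment_le)
      show "nabla d ?f vs differentiable_on Rd d"
        using f vs by (simp add: times_differentiable_def)
      fix z assume z: "z \<in> Rd d"
      have "\<bar>nabla d ?f ((x - y) # vs) z\<bar> \<le> a * b ^ Suc p * (B * (norm (x - y) * ?P))"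
        using bound[of "(x - y) # vs" z] vs z x y Rd_diff by (simp del: nabla.simps)
      also have "\<dots> = a * b ^ p * B * ?t * ?P"
        by (simp add: mult_ac)
      also have "\<dots> \<le> a * b ^ p * B * ?t * 1"
        by (intro mult_left_mono P mult_nonneg_nonneg C) (use b in auto)
      finally show "\<bar>nabla d ?f ((x - y) # vs) z\<bar> \<le> a * b ^ p * B * ?t"
        by simp
    qed (rule x y)+
    moreover have "\<bar>nabla d ?f vs x - nabla d ?f vs y\<bar> \<le> a * b ^ p * B * 2"
      using bp[OF x] bp[OF y] by linarith
    ultimately have "\<bar>nabla d ?f vs x - nabla d ?f vs y\<bar> \<le> a * b ^ p * B * min 2 ?t"
      by (simp add: min_def)
    also have "\<dots> \<le> a * b ^ p * B * (2 * ?t powr \<nu>)"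
      using b by (intro mult_left_mono min_le_powr \<nu> C) auto
    also have "\<dots> = 2 * a * B * b powr (real p + \<nu>) * norm (x - y) powr \<nu>"
      using b by (simp add: powr_mult powr_add powr_realpow mult_ac)
    finally show "\<bar>nabla d ?f vs x - nabla d ?f vs y\<bar> \<le> 2 * a * B * b powr (real p + \<nu>) * norm (x - y) powr \<nu>" .
  qed
  moreover have "times_differentiable d p ?f"
    using f by (rule times_differentiable_mono) simp
  ultimately show ?thesis
    by (simp add: holder_smooth_def)
qed

section \<open>Uniform convexity and minimizers\<close>

lemma power_diff_same_sign:
  fixes a b :: real
  assumes "0 \<le> a" "0 \<le> b"
  shows "0 \<le> (a ^ m - b ^ m) * (a - b)"
proof (cases "a \<le> b")
  case True
  then show ?thesis
    using assms power_mono[of a b m] by (intro mult_nonpos_nonpos) auto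
next
  case False
  then show ?thesis
    using assms power_mono[of b a m] by (intro mult_nonneg_nonneg) auto
qed

text \<open>The induction step is Chebyshev's sum inequality for two terms, in the form of
  \<open>power_diff_same_sign\<close>.\<close>

lemma power_mean_two:
  fixes a b :: real
  assumes "0 \<le> a" "0 \<le> b"
  shows "((a + b) / 2) ^ m \<le> (a ^ m + b ^ m) / 2"
proof (induction m)
  case (Suc m)
  have "((a + b) / 2) ^ Suc m \<le> (a ^ m + b ^ m) / 2 * ((a + b) / 2)"
    unfolding power_Suc2 using Suc assms by (intro mult_right_mono) auto
  also have "\<dots> = (a ^ Suc m + b ^ Suc m) / 2 - (a ^ m - b ^ m) * (a - b) / 4"
    by (simp add: field_simps)
  also have "\<dots> \<le> (a ^ Suc m + b ^ Suc m) / 2"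
    unfolding diff_le_eq le_add_same_cancel1 using power_diff_same_sign[OF assms, of m] by simp
  finally show ?case .
qed simp

text \<open>The right-hand side is the mean of the two powers times the squared distance plus a
  nonnegative term. The power mean inequality and the triangle inequality bound that mean from below
  by \<open>norm (y - x) ^ m / 2 ^ m\<close>.\<close>

lemma norm_power_gradient_monotone:
  fixes x y :: "'a :: real_inner"
  shows "norm (y - x) ^ (m + 2) / 2 ^ m \<le> norm y ^ m * inner y (y - x) - norm x ^ m * inner x (y - x)"
proof -
  let ?a = "norm y" and ?b = "norm x"
  have xy: "norm (y - x) ^ 2 = ?a ^ 2 - 2 * inner x y + ?b ^ 2"
    by (simp add: power2_norm_eq_inner inner_diff inner_commute)
  have "norm (y - x) ^ m \<le> (?a + ?b) ^ m"
    by (intro power_mono norm_triangle_ineq4) simp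
  then have "norm (y - x) ^ m / 2 ^ m \<le> ((?a + ?b) / 2) ^ m"
    by (simp add: power_divide divide_right_mono)
  also have "\<dots> \<le> (?a ^ m + ?b ^ m) / 2"
    by (intro power_mean_two) auto
  finally have 3: "norm (y - x) ^ m / 2 ^ m * norm (y - x) ^ 2 \<le> (?a ^ m + ?b ^ m) / 2 * norm (y - x) ^ 2"
    by (rule mult_right_mono) simp
  have 4: "0 \<le> (?a ^ m - ?b ^ m) * (?a - ?b) * (?a + ?b) / 2"
    using power_diff_same_sign[of ?a ?b m] by simp
  have 5: "norm y ^ m * inner y (y - x) - norm x ^ m * inner x (y - x) =
      (?a ^ m + ?b ^ m) / 2 * norm (y - x) ^ 2 + (?a ^ m - ?b ^ m) * (?a - ?b) * (?a + ?b) / 2"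
  proof -
    have 1: "inner y (y - x) = ?a ^ 2 - inner x y" and 2: "inner x (y - x) = inner x y - ?b ^ 2"
      by (simp_all add: inner_diff_right power2_norm_eq_inner inner_commute)
    show ?thesis
      unfolding xy 1 2 by (simp add: field_simps power2_eq_square)
  qed
  have "norm (y - x) ^ (m + 2) / 2 ^ m = norm (y - x) ^ m / 2 ^ m * norm (y - x) ^ 2"
    by (simp only: power_add times_divide_eq_left)
  then show ?thesis
    unfolding 5 using 3 4 by linarith
qed

text \<open>The origin is treated separately: the norm itself is not differentiable there, but a
  power of at least 2 has derivative 0.\<close>

lemma norm_power_has_derivative:
  fixes x :: "'a :: real_inner"
  shows "((\<lambda>x. norm x ^ (m + 2)) has_derivative (\<lambda>h. real (m + 2) * norm x ^ m * inner x h)) (at x within S)"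
proof (cases "x = 0")
  case False
  have "((\<lambda>x. norm x ^ (m + 2)) has_derivative
      (\<lambda>h. of_nat (m + 2) * inner h (sgn x) * norm x ^ (m + 2 - 1))) (at x)"
    by (rule has_derivative_power[OF has_derivative_norm[OF False]])
  moreover have "of_nat (m + 2) * inner h (sgn x) * norm x ^ (m + 2 - 1) = real (m + 2) * norm x ^ m * inner x h" for h
    using False by (simp add: sgn_div_norm inner_commute[of h])
  ultimately have "((\<lambda>x. norm x ^ (m + 2)) has_derivative (\<lambda>h. real (m + 2) * norm x ^ m * inner x h)) (at x)"
    by (simp only:)
  then show ?thesis
    by (rule has_derivative_at_withinI)
next
  case True
  have "((\<lambda>h :: 'a. norm h ^ (m + 1)) \<longlongrightarrow> norm (0 :: 'a) ^ (m + 1)) (at 0)"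
    by (intro tendsto_intros)
  moreover have "norm (norm (0 + h) ^ (m + 2) - norm (0 :: 'a) ^ (m + 2) - 0) / norm h = norm h ^ (m + 1)" for h :: 'a
    by (cases "h = 0") simp_all
  ultimately have "((\<lambda>h :: 'a. norm (norm (0 + h) ^ (m + 2) - norm (0 :: 'a) ^ (m + 2) - 0) / norm h) \<longlongrightarrow> 0) (at 0)"
    by (simp only: norm_zero) simp
  then have "((\<lambda>x :: 'a. norm x ^ (m + 2)) has_derivative (\<lambda>_. 0)) (at 0)"
    unfolding has_derivative_at by simp
  then show ?thesis
    using True by (simp add: has_derivative_at_withinI)
qed

text \<open>The gradient inequality integrated along the segment: \<open>?\<phi>\<close> is the
  difference of both sides at the point \<open>x + t *\<^sub>R h\<close>, and its derivative is
  nonnegative.\<close>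

lemma norm_power_uniformly_convex:
  fixes x y :: "'a :: real_inner"
  shows "norm (y - x) ^ (m + 2) / (real (m + 2) * 2 ^ m) \<le>
    norm y ^ (m + 2) / real (m + 2) - norm x ^ (m + 2) / real (m + 2) - norm x ^ m * inner x (y - x)"
proof -
  define h where "h = y - x"
  let ?q = "real (m + 2)"
  let ?\<phi> = "\<lambda>t. norm (x + t *\<^sub>R h) ^ (m + 2) / ?q - t * (norm x ^ m * inner x h)
    - t ^ (m + 2) * (norm h ^ (m + 2) / (?q * 2 ^ m))"
  let ?\<phi>' = "\<lambda>t. norm (x + t *\<^sub>R h) ^ m * inner (x + t *\<^sub>R h) h - norm x ^ m * inner x h
    - t ^ (m + 1) * (norm h ^ (m + 2) / 2 ^ m)"
  have "?\<phi> 0 \<le> ?\<phi> 1"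
  proof (rule DERIV_nonneg_imp_nondecreasing[where f = ?\<phi>])
    fix t :: real assume t: "0 \<le> t" "t \<le> 1"
    have "((\<lambda>t. norm (x + t *\<^sub>R h) ^ (m + 2)) has_derivative
        (\<lambda>s. ?q * norm (x + t *\<^sub>R h) ^ m * inner (x + t *\<^sub>R h) (s *\<^sub>R h))) (at t)"
      by (rule has_derivative_compose[where f = "\<lambda>t. x + t *\<^sub>R h" and f' = "\<lambda>s. s *\<^sub>R h", OF _ norm_power_has_derivative])
        (auto intro!: derivative_eq_intros)
    then have n: "((\<lambda>t. norm (x + t *\<^sub>R h) ^ (m + 2)) has_real_derivative
        ?q * norm (x + t *\<^sub>R h) ^ m * inner (x + t *\<^sub>R h) h) (at t)"
      unfolding has_field_derivative_def by (rule has_derivative_eq_rhs) (auto simp: mult_ac)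
    have "(?\<phi> has_real_derivative ?q * norm (x + t *\<^sub>R h) ^ m * inner (x + t *\<^sub>R h) h / ?q
        - 1 * (norm x ^ m * inner x h) - ?q * t ^ (m + 1) * (norm h ^ (m + 2) / (?q * 2 ^ m))) (at t)"
      by (intro DERIV_diff DERIV_cdivide n DERIV_cmult_right DERIV_ident)
        (use DERIV_pow[of "m + 2" t] in simp)
    then have "(?\<phi> has_real_derivative ?\<phi>' t) (at t)"
    proof (rule DERIV_cong)
      have *: "q * a * b / q - 1 * c - q * u * (w / (q * v)) = a * b - c - u * (w / v)" if "q \<noteq> 0"
        for a b c q u v w :: real
        using that by simp
      show "?q * norm (x + t *\<^sub>R h) ^ m * inner (x + t *\<^sub>R h) h / ?q - 1 * (norm x ^ m * inner x h)
          - ?q * t ^ (m + 1) * (norm h ^ (m + 2) / (?q * 2 ^ m)) = ?\<phi>' t"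
        by (rule *) simp
    qed
    moreover have "0 \<le> ?\<phi>' t"
    proof (cases "t = 0")
      case False
      then have "0 < t" using t by simp
      \<comment> \<open>Gradient monotonicity between \<open>x + t *\<^sub>R h\<close> and
        \<open>x\<close>; the displacement contributes a factor \<open>t\<close>, which is cancelled
        afterwards.\<close>
      have "t ^ (m + 2) * norm h ^ (m + 2) / 2 ^ m \<le>
          t * (norm (x + t *\<^sub>R h) ^ m * inner (x + t *\<^sub>R h) h - norm x ^ m * inner x h)"
        using norm_power_gradient_monotone[of "x + t *\<^sub>R h" x m] \<open>0 < t\<close>
        by (simp add: power_mult_distrib algebra_simps)
      also have "t ^ (m + 2) * norm h ^ (m + 2) / 2 ^ m = t * (t ^ (m + 1) * (norm h ^ (m + 2) / 2 ^ m))"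
        by simp
      finally show ?thesis
        using \<open>0 < t\<close> by (simp only: mult_le_cancel_left_pos)
    qed simp
    ultimately show "\<exists>y. (?\<phi> has_real_derivative y) (at t) \<and> 0 \<le> y"
      by blast
  qed simp
  then show ?thesis
    by (simp add: h_def)
qed

text \<open>Convexity bounds the difference quotients along the segment by \<open>f y - f x\<close>,
  and the directional derivative is their limit from the right.\<close>

lemma convex_on_gradient_le:
  assumes f: "convex_on (Rd d) f" "f differentiable_on Rd d" and x: "x \<in> Rd d" and y: "y \<in> Rd d"
  shows "nabla d f [y - x] x \<le> f y - f x"
proof -
  let ?g = "\<lambda>t. f (x + t *\<^sub>R (y - x))"
  have slope: "(c - a) / t \<le> b - a" if "c \<le> (1 - t) * a + t * b" "0 < t" for a b c t :: real
    using that by (simp add: field_simps)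
  have "(f has_derivative (\<lambda>v. nabla d f [v] x)) (at (x + 0 *\<^sub>R (y - x)) within Rd d)"
    using nabla_single_has_derivative[OF f(2) x] by simp
  then have "(?g has_real_derivative nabla d f [y - x] x) (at 0)"
    by (rule has_real_derivative_line[where D = "\<lambda>v. nabla d f [v] x"]) (rule x Rd_diff y)+
  then have "((\<lambda>t. (?g (0 + t) - ?g 0) / t) \<longlongrightarrow> nabla d f [y - x] x) (at 0)"
    unfolding DERIV_def .
  then have "((\<lambda>t. (?g (0 + t) - ?g 0) / t) \<longlongrightarrow> nabla d f [y - x] x) (at_right 0)"
    by (rule tendsto_mono[OF at_le[OF subset_UNIV]])
  then have "((\<lambda>t. (?g t - f x) / t) \<longlongrightarrow> nabla d f [y - x] x) (at_right 0)"
    by (simp only: add_0 scaleR_zero_left add_0_right)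
  moreover have "eventually (\<lambda>t. (?g t - f x) / t \<le> f y - f x) (at_right 0)"
    unfolding eventually_at_right_field
  proof (intro exI[of _ 1] conjI allI impI)
    fix t :: real assume t: "0 < t" "t < 1"
    have "x + t *\<^sub>R (y - x) = (1 - t) *\<^sub>R x + t *\<^sub>R y"
      by (rule fseq_eqI) (simp add: algebra_simps)
    then have "?g t \<le> (1 - t) * f x + t * f y"
      using convex_onD[OF f(1), of t x y] t x y by simp
    then show "(?g t - f x) / t \<le> f y - f x"
      using t(1) by (rule slope)
  qed (rule zero_less_one)
  ultimately show ?thesis
    by (rule tendsto_upperbound) simp
qed

lemma nabla_add_norm_power:
  assumes f: "f differentiable_on Rd d" and x: "x \<in> Rd d"
  shows "((\<lambda>x. f x + \<sigma> / real (m + 2) * norm x ^ (m + 2)) has_derivative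
      (\<lambda>v. nabla d f [v] x + \<sigma> * (norm x ^ m * inner x v))) (at x within Rd d)"
    and "v \<in> Rd d \<Longrightarrow> nabla d (\<lambda>x. f x + \<sigma> / real (m + 2) * norm x ^ (m + 2)) [v] x =
      nabla d f [v] x + \<sigma> * (norm x ^ m * inner x v)"
proof -
  have "((\<lambda>x. f x + \<sigma> / real (m + 2) * norm x ^ (m + 2)) has_derivative
      (\<lambda>v. nabla d f [v] x + \<sigma> / real (m + 2) * (real (m + 2) * norm x ^ m * inner x v))) (at x within Rd d)"
    by (intro has_derivative_add has_derivative_mult_right norm_power_has_derivative nabla_single_has_derivative f x)
  then show *: "((\<lambda>x. f x + \<sigma> / real (m + 2) * norm x ^ (m + 2)) has_derivative
      (\<lambda>v. nabla d f [v] x + \<sigma> * (norm x ^ m * inner x v))) (at x within Rd d)"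
    by (rule has_derivative_eq_rhs) (auto simp: mult.assoc)
  show "v \<in> Rd d \<Longrightarrow> nabla d (\<lambda>x. f x + \<sigma> / real (m + 2) * norm x ^ (m + 2)) [v] x =
      nabla d f [v] x + \<sigma> * (norm x ^ m * inner x v)"
    by (rule nabla_singleI[OF * x])
qed

text \<open>The convex part contributes a nonnegative term to both inequalities, so the modulus is
  that of the power of the norm.\<close>

lemma uniformly_convex_add_norm_power:
  assumes f: "convex_on (Rd d) f" "f differentiable_on Rd d" and \<sigma>: "0 < \<sigma>" and q: "2 \<le> q"
  shows "uniformly_convex d q (\<sigma> / 2 ^ (q - 2)) (\<lambda>x. f x + \<sigma> / real q * norm x ^ q)"
proof -
  define m where "m = q - 2"
  have qm: "q = m + 2" using q by (simp add: m_def)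
  let ?F = "\<lambda>x. f x + \<sigma> / real (m + 2) * norm x ^ (m + 2)"
  note nab = nabla_add_norm_power[OF f(2), where m = m and \<sigma> = \<sigma>]
  have "?F differentiable_on Rd d"
    using nab(1) unfolding differentiable_on_def differentiable_def by blast
  then have td: "times_differentiable d 1 ?F"
    by (simp add: times_differentiable_Suc times_differentiable_0)
  have 1: "\<sigma> / 2 ^ m / real (m + 2) * norm (y - x) ^ (m + 2) \<le> ?F y - ?F x - nabla d ?F [y - x] x"
    if x: "x \<in> Rd d" and y: "y \<in> Rd d" for x y
  proof -
    have "\<sigma> / 2 ^ m / real (m + 2) * norm (y - x) ^ (m + 2) = \<sigma> * (norm (y - x) ^ (m + 2) / (real (m + 2) * 2 ^ m))"
      by (simp add: field_simps)
    also have "\<dots> \<le> \<sigma> * (norm y ^ (m + 2) / real (m + 2) - norm x ^ (m + 2) / real (m + 2) - norm x ^ m * inner x (y - x))"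
      using \<sigma> by (intro mult_left_mono norm_power_uniformly_convex) simp
    also have "\<dots> \<le> \<dots> + (f y - f x - nabla d f [y - x] x)"
      using convex_on_gradient_le[OF f x y] by simp
    also have "\<dots> = ?F y - ?F x - nabla d ?F [y - x] x"
      unfolding nab(2)[OF x Rd_diff[OF y x]] by (simp add: algebra_simps)
    finally show ?thesis .
  qed
  have 2: "\<sigma> / 2 ^ m * norm (y - x) ^ (m + 2) \<le> nabla d ?F [y - x] y - nabla d ?F [y - x] x"
    if x: "x \<in> Rd d" and y: "y \<in> Rd d" for x y
  proof -
    have "nabla d f [x - y] y = - nabla d f [y - x] y"
      using linear_neg[OF has_derivative_linear[OF nabla_single_has_derivative[OF f(2) y]], of "y - x"] by simp
    then have 3: "nabla d f [y - x] x \<le> nabla d f [y - x] y"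
      using convex_on_gradient_le[OF f x y] convex_on_gradient_le[OF f y x] by linarith
    have "\<sigma> / 2 ^ m * norm (y - x) ^ (m + 2) = \<sigma> * (norm (y - x) ^ (m + 2) / 2 ^ m)"
      by simp
    also have "\<dots> \<le> \<sigma> * (norm y ^ m * inner y (y - x) - norm x ^ m * inner x (y - x))"
      using \<sigma> by (intro mult_left_mono norm_power_gradient_monotone) simp
    also have "\<dots> \<le> nabla d ?F [y - x] y - nabla d ?F [y - x] x"
      unfolding nab(2)[OF x Rd_diff[OF y x]] nab(2)[OF y Rd_diff[OF y x]] right_diff_distrib using 3 by linarith
    finally show ?thesis .
  qed
  show ?thesis
    unfolding uniformly_convex_def qm using td 1 2 by (simp del: nabla.simps)
qed

section \<open>Existence and uniqueness of the minimizer\<close>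

definition fvec :: "nat \<Rightarrow> (nat \<Rightarrow> real) \<Rightarrow> fseq" where
  "fvec d g = Abs_fseq (\<lambda>i. if i < d then g i else 0)"

lemma coord_fvec: "coord (fvec d g) i = (if i < d then g i else 0)"
proof -
  have "finite {i. (if i < d then g i else 0) \<noteq> 0}"
    by (rule finite_subset[of _ "{..<d}"]) auto
  then show ?thesis
    by (simp add: fvec_def Abs_fseq_inverse)
qed

lemma fvec_in_Rd: "fvec d g \<in> Rd d"
  by (simp add: Rd_def coord_fvec)

text \<open>The ambient space is infinite dimensional, so being closed and bounded does not suffice.
  The induction presents each box as a continuous image of the preceding one times an
  interval.\<close>

lemma compact_Rd_box: "compact {x \<in> Rd d. \<forall>i. \<bar>coord x i\<bar> \<le> r}"
proof (cases "0 \<le> r")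
  case False
  then have "\<not> \<bar>coord x 0\<bar> \<le> r" for x
    using abs_ge_zero[of "coord x 0"] by linarith
  then have "{x \<in> Rd d. \<forall>i. \<bar>coord x i\<bar> \<le> r} = {}"
    by blast
  then show ?thesis by (simp only: compact_empty)
next
  case r: True
  show ?thesis
  proof (induction d)
    case 0
    have "{x \<in> Rd 0. \<forall>i. \<bar>coord x i\<bar> \<le> r} = {0}"
      using r by (auto simp: Rd_def intro: fseq_eqI)
    then show ?case by simp
  next
    case (Suc d)
    define e where "e = fvec (Suc d) (\<lambda>i. if i = d then 1 else 0)"
    have e: "coord e i = (if i = d then 1 else 0)" for i
      by (simp add: e_def coord_fvec)
    let ?K = "\<lambda>d. {x \<in> Rd d. \<forall>i. \<bar>coord x i\<bar> \<le> r}"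
    let ?\<phi> = "\<lambda>p. fst p + snd p *\<^sub>R e"
    have "compact (?\<phi> ` (?K d \<times> {-r..r}))"
      by (intro compact_continuous_image compact_Times Suc continuous_intros) simp
    also have "?\<phi> ` (?K d \<times> {-r..r}) = ?K (Suc d)"
    proof (intro equalityI subsetI)
      fix x assume x: "x \<in> ?K (Suc d)"
      have "x = ?\<phi> (x - coord x d *\<^sub>R e, coord x d)"
        by simp
      moreover have "x - coord x d *\<^sub>R e \<in> ?K d"
      proof -
        have z: "coord x i = 0" if "d < i" for i
          using x that by (simp add: Rd_def)
        have c: "coord (x - coord x d *\<^sub>R e) i = (if i = d then 0 else coord x i)" for i
          by (simp add: e)
        show ?thesis
          using x r z by (simp add: Rd_def c del: coord_simps)
      qed
      moreover have "coord x d \<in> {-r..r}"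
      proof -
        have "\<bar>coord x d\<bar> \<le> r" using x by blast
        then show ?thesis by auto
      qed
      ultimately show "x \<in> ?\<phi> ` (?K d \<times> {-r..r})"
        by blast
    next
      fix x assume "x \<in> ?\<phi> ` (?K d \<times> {-r..r})"
      then obtain y t where "x = y + t *\<^sub>R e" "y \<in> ?K d" "-r \<le> t" "t \<le> r"
        by auto
      then have "coord x i = (if i = d then t else coord y i)" "\<bar>coord y i\<bar> \<le> r" for i
        by (auto simp: Rd_def e)
      with \<open>y \<in> ?K d\<close> \<open>-r \<le> t\<close> \<open>t \<le> r\<close> show "x \<in> ?K (Suc d)"
        by (auto simp: Rd_def)
    qed
    finally show ?case .
  qed
qed

lemma minimizer_exists:
  fixes F :: "fseq \<Rightarrow> real"
  assumes F: "continuous_on (Rd d) F" and r: "\<And>x. x \<in> Rd d \<Longrightarrow> r < norm x \<Longrightarrow> F 0 < F x"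
  shows "\<exists>xs\<in>Rd d. \<forall>x\<in>Rd d. F xs \<le> F x"
proof -
  \<comment> \<open>The maximum puts 0 into the box even if \<open>r\<close> is negative, so that
    the minimum over the box is at most \<open>F 0\<close>.\<close>
  let ?r = "max r 0" and ?K = "{x \<in> Rd d. \<forall>i. \<bar>coord x i\<bar> \<le> max r 0}"
  have 0: "0 \<in> ?K" by (simp add: Rd_0)
  have "continuous_on ?K F"
    using F by (rule continuous_on_subset) auto
  then obtain xs where xs: "xs \<in> ?K" "\<And>x. x \<in> ?K \<Longrightarrow> F xs \<le> F x"
    using continuous_attains_inf[OF compact_Rd_box, of d ?r F] 0 by blast
  have "F xs \<le> F x" if x: "x \<in> Rd d" for x
  proof (cases "x \<in> ?K")
    case False
    then obtain i where "?r < \<bar>coord x i\<bar>"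
      using x by (auto simp: not_le)
    then have "r < norm x"
      using abs_coord_le_norm[of x i] by simp
    then show ?thesis
      using r[OF x] xs(2)[OF 0] by simp
  qed (rule xs(2))
  then show ?thesis
    using xs(1) by blast
qed

text \<open>Uniform convexity is applied at the midpoint towards both minimizers. The two gradient
  terms are opposite, so the midpoint would have a strictly smaller value.\<close>

lemma uniformly_convex_unique_min:
  assumes F: "uniformly_convex d q \<sigma> F" "0 < \<sigma>" "1 \<le> q"
    and x: "x \<in> Rd d" "\<And>z. z \<in> Rd d \<Longrightarrow> F x \<le> F z" and y: "y \<in> Rd d" "\<And>z. z \<in> Rd d \<Longrightarrow> F y \<le> F z"
  shows "x = y"
proof (rule ccontr)
  assume "x \<noteq> y"
  define m where "m = (1 / 2) *\<^sub>R (x + y)"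
  have m: "m \<in> Rd d"
    unfolding m_def by (intro Rd_scale Rd_add x y)
  have d: "F differentiable_on Rd d"
    using F(1) times_differentiable_SucD(1)[of d 0 F] by (simp add: uniformly_convex_def)
  have e: "y - m = - (x - m)"
    by (rule fseq_eqI) (simp add: m_def field_simps)
  have "nabla d F [y - m] m = - nabla d F [x - m] m"
    unfolding e using linear_neg[OF has_derivative_linear[OF nabla_single_has_derivative[OF d m]]] .
  moreover have "\<sigma> / real q * norm (x - m) ^ q \<le> F x - F m - nabla d F [x - m] m"
    "\<sigma> / real q * norm (y - m) ^ q \<le> F y - F m - nabla d F [y - m] m"
    using F(1) x y m unfolding uniformly_convex_def by blast+
  moreover have "x - m = (1 / 2) *\<^sub>R (x - y)"
    by (rule fseq_eqI) (simp add: m_def field_simps)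
  then have "0 < \<sigma> / real q * norm (x - m) ^ q"
    using \<open>x \<noteq> y\<close> F(2,3) by simp
  moreover have "0 \<le> \<sigma> / real q * norm (y - m) ^ q"
    using F(2) by simp
  ultimately show False
    using x(2)[OF m] y(2)[OF m] by linarith
qed

lemma power_dominates_linear:
  fixes A B s :: real
  assumes "0 < s" "2 \<le> q" "0 \<le> A"
  shows "\<exists>r. \<forall>t>r. B < s * t ^ q - A * t"
proof (intro exI allI impI)
  \<comment> \<open>Beyond 1 the power \<open>t ^ q\<close> is at least the square; the other
    threshold makes \<open>s * t\<close> at least \<open>A + \<bar>B\<bar> + 1\<close>.\<close>
  fix t assume t: "max 1 ((A + \<bar>B\<bar> + 1) / s) < t"
  have "A + \<bar>B\<bar> + 1 \<le> s * t"
    using t assms(1) by (simp add: field_simps)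
  then have "(A + \<bar>B\<bar> + 1) * t \<le> s * t * t"
    using t by (intro mult_right_mono) auto
  also have "\<dots> = s * t ^ 2"
    by (simp add: power2_eq_square)
  also have "\<dots> \<le> s * t ^ q"
    using t assms by (intro mult_left_mono power_increasing) auto
  finally have "(\<bar>B\<bar> + 1) * t \<le> s * t ^ q - A * t"
    by (simp add: algebra_simps)
  moreover have "B < (\<bar>B\<bar> + 1) * 1"
    by simp
  moreover have "(\<bar>B\<bar> + 1) * 1 \<le> (\<bar>B\<bar> + 1) * t"
    using t by (intro mult_left_mono) auto
  ultimately show "B < s * t ^ q - A * t"
    by (meson less_le_trans)
qed

section \<open>The resisting oracle\<close>

lemma length_answers [simp]: "length (answers d p A F t) = t"
  by (induction t) auto

lemma local_info_cong_open:
  assumes "open U" "x \<in> U" "x \<in> Rd d" "\<And>z. z \<in> U \<inter> Rd d \<Longrightarrow> F z = G z"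
  shows "local_info d p F x = local_info d p G x"
  using nabla_cong_open[of U d F G x] assms by (auto simp: local_info_def)

definition admissible :: "nat \<Rightarrow> (nat \<times> real) list \<Rightarrow> bool" where
  "admissible d L \<longleftrightarrow> distinct (map fst L) \<and> fst ` set L \<subseteq> {..<d} \<and> (\<forall>e\<in>set L. \<bar>snd e\<bar> = 1)"

text \<open>
  The adversary: at each query it spends an unused coordinate on which the query is largest in
  absolute value, with the sign that makes the new link nonnegative there. This link then hides all
  later ones at that query point.
\<close>

lemma resisting_chain:
  assumes A: "is_algorithm d T A" and T: "T \<le> d"
    and loc: "\<And>L e M x. x \<in> Rd d \<Longrightarrow> admissible d (L @ e # M) \<Longrightarrow>
      \<forall>e'\<in>set M. \<bar>coord x (fst e')\<bar> \<le> snd e * coord x (fst e) \<Longrightarrow>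
      local_info d p (G (L @ e # M)) x = local_info d p (G (L @ [e])) x"
  shows "t \<le> T \<Longrightarrow> \<exists>L. length L = t \<and> admissible d L \<and>
    (\<forall>M. admissible d (L @ M) \<longrightarrow> answers d p A (G (L @ M)) t = answers d p A (G L) t) \<and>
    (0 < t \<longrightarrow> 0 \<le> snd (last L) * coord (iterate d p A (G L) t) (fst (last L)))"
proof (induction t)
  case 0
  show ?case
    by (rule exI[of _ "[]"]) (simp add: admissible_def)
next
  case (Suc t)
  have "t \<le> T"
    using Suc.prems by simp
  from Suc.IH[OF this] obtain L where L: "length L = t" "admissible d L"
    and ans: "\<And>M. admissible d (L @ M) \<Longrightarrow> answers d p A (G (L @ M)) t = answers d p A (G L) t"
    by blast
  define x where "x = A (answers d p A (G L) t)"
  have x: "x \<in> Rd d"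
    using A Suc.prems unfolding is_algorithm_def x_def by simp
  \<comment> \<open>The coordinates not yet disclosed; there is one left because fewer than T \<le>
    d have been used.\<close>
  define J where "J = {..<d} - fst ` set L"
  have "card (fst ` set L) \<le> t"
    using L(1) card_image_le[of "set L" fst] card_length[of L] by simp
  then have "card (fst ` set L) < card {..<d}"
    using Suc.prems T by simp
  then have J: "finite J" "J \<noteq> {}"
    unfolding J_def using card_mono[of "fst ` set L" "{..<d}"] by auto
  then have "Max ((\<lambda>j. \<bar>coord x j\<bar>) ` J) \<in> (\<lambda>j. \<bar>coord x j\<bar>) ` J"
    by (intro Max_in) auto
  then obtain i where "i \<in> J" and Max: "Max ((\<lambda>j. \<bar>coord x j\<bar>) ` J) = \<bar>coord x i\<bar>"
    by blast
  then have i: "i \<in> J" "\<And>j. j \<in> J \<Longrightarrow> \<bar>coord x j\<bar> \<le> \<bar>coord x i\<bar>"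
    using J(1) unfolding Max[symmetric] by auto
  \<comment> \<open>With this sign the value of the new link at \<open>x\<close> is an absolute
    value that is maximal over \<open>J\<close>, so it dominates later links whatever signs they
    receive.\<close>
  define e where "e = (i, if 0 \<le> coord x i then 1 else (-1 :: real))"
  have e: "snd e * coord x (fst e) = \<bar>coord x i\<bar>"
    by (simp add: e_def)
  let ?L = "L @ [e]"
  have adm: "admissible d ?L"
    using L(2) i(1) by (auto simp: admissible_def J_def e_def)
  \<comment> \<open>The induction hypothesis speaks of all admissible extensions. Appending
    \<open>e\<close> and anything after it leaves the earlier answers alone, so the query
    \<open>x\<close>, on which \<open>e\<close> depends, is not altered by \<open>e\<close>.\<close>
  have ans': "answers d p A (G (?L @ M)) t = answers d p A (G L) t" if "admissible d (?L @ M)" for M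
    using ans[of "e # M"] that by simp
  have ans1: "answers d p A (G ?L) t = answers d p A (G L) t"
    using ans[of "[e]"] adm by simp
  have step: "answers d p A (G (?L @ M)) (Suc t) = answers d p A (G ?L) (Suc t)" if M: "admissible d (?L @ M)" for M
  proof -
    have "fst e' \<in> J" if "e' \<in> set M" for e'
      using M that by (auto simp: admissible_def J_def)
    then have "local_info d p (G (L @ e # M)) x = local_info d p (G (L @ [e])) x"
      using M by (intro loc x) (auto simp: e i(2))
    then have "local_info d p (G (?L @ M)) x = local_info d p (G ?L) x"
      by simp
    then show ?thesis
      by (simp only: answers.simps ans'[OF M] ans1 flip: x_def)
  qed
  have it: "iterate d p A (G ?L) (Suc t) = x"
    using ans1 by (simp add: iterate_def x_def)
  show ?case
  proof (intro exI[of _ ?L] conjI allI impI)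
    show "length ?L = Suc t" "admissible d ?L"
      using L(1) adm by simp_all
    show "0 \<le> snd (last ?L) * coord (iterate d p A (G ?L) (Suc t)) (fst (last ?L))"
      unfolding it last_snoc e by simp
  qed (rule step)
qed

text \<open>In the ball of radius \<open>1 / (2 * b)\<close> every scaled coordinate moves by at
  most \<open>1 / 2\<close>, so two links change relative to each other by at most 1, exactly the
  slack in \<open>chain_prefix\<close>. The functions agree on a neighbourhood, hence so do all
  derivatives at \<open>x\<close>.\<close>

lemma local_info_chain_prefix:
  assumes b: "0 < b" and x: "x \<in> Rd d" and M: "admissible d (L @ e # M)"
    and dom: "\<forall>e'\<in>set M. \<bar>coord x (fst e')\<bar> \<le> snd e * coord x (fst e)"
    and G: "\<And>L. G L = (\<lambda>x. a * chain (Suc n) 0 L (b *\<^sub>R x) + g x)"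
  shows "local_info d p (G (L @ e # M)) x = local_info d p (G (L @ [e])) x"
proof (rule local_info_cong_open)
  show "open (ball x (1 / (2 * b)))" "x \<in> ball x (1 / (2 * b))"
    using b by auto
  show "x \<in> Rd d" by (rule x)
  fix z assume "z \<in> ball x (1 / (2 * b)) \<inter> Rd d"
  then have "b * norm (z - x) \<le> 1 / 2"
    using b by (simp add: dist_norm norm_minus_commute field_simps)
  then have close: "b * \<bar>coord z i - coord x i\<bar> \<le> 1 / 2" for i
  proof -
    have "b * \<bar>coord (z - x) i\<bar> \<le> b * norm (z - x)"
      using b by (intro mult_left_mono abs_coord_le_norm) simp
    then show ?thesis
      using \<open>b * norm (z - x) \<le> 1 / 2\<close> by simp
  qed
  have s: "\<bar>s * coord z i * b - s * coord x i * b\<bar> \<le> 1 / 2" if "\<bar>s\<bar> = 1" for s i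
  proof -
    have "s * coord z i * b - s * coord x i * b = s * (coord z i - coord x i) * b"
      by (simp add: algebra_simps)
    then show ?thesis
      using close[of i] that b by (simp add: abs_mult mult.commute)
  qed
  have "snd e' * coord (b *\<^sub>R z) (fst e') \<le> snd e * coord (b *\<^sub>R z) (fst e) + 1" if e': "e' \<in> set M" for e'
  proof -
    have "\<bar>snd e'\<bar> = 1" "\<bar>snd e\<bar> = 1"
      using M e' by (auto simp: admissible_def)
    note s1 = s[OF this(1), of "fst e'"] and s2 = s[OF this(2), of "fst e"]
    have "snd e' * coord x (fst e') \<le> snd e * coord x (fst e)"
      using dom e' abs_le_D1[of "snd e' * coord x (fst e')"] \<open>\<bar>snd e'\<bar> = 1\<close> by (force simp: abs_mult)
    then have "snd e' * coord x (fst e') * b \<le> snd e * coord x (fst e) * b"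
      using b by (intro mult_right_mono) auto
    then have "snd e' * coord z (fst e') * b \<le> snd e * coord z (fst e) * b + 1"
      using s1 s2 by linarith
    then show ?thesis
      by (simp add: mult_ac)
  qed
  then show "G (L @ e # M) z = G (L @ [e]) z"
    unfolding G by (subst chain_prefix) auto
qed

section \<open>A point of low value, and the exponents of the rate\<close>

lemma exists_opposite_point:
  assumes "admissible d L" "0 \<le> \<rho>"
  shows "\<exists>x\<in>Rd d. norm x \<le> \<rho> * sqrt (real (length L)) \<and> (\<forall>e\<in>set L. snd e * coord x (fst e) = - \<rho>)"
proof -
  \<comment> \<open>The value 0 off the chain keeps the norm down; distinctness of the coordinates
    makes the lookup return the sign of the intended link.\<close>
  define g where "g i = (case map_of L i of None \<Rightarrow> 0 | Some s \<Rightarrow> - \<rho> * s)" for i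
  have L: "distinct (map fst L)" "fst ` set L \<subseteq> {..<d}" "\<And>e. e \<in> set L \<Longrightarrow> \<bar>snd e\<bar> = 1"
    using assms(1) by (auto simp: admissible_def)
  have g: "g (fst e) = - \<rho> * snd e" if "e \<in> set L" for e
    using map_of_is_SomeI[OF L(1), of "fst e" "snd e"] that by (simp add: g_def)
  have "(\<Sum>i<d. (coord (fvec d g) i)\<^sup>2) = (\<Sum>i<d. (g i)\<^sup>2)"
    by (simp add: coord_fvec)
  also have "\<dots> = (\<Sum>i\<in>fst ` set L. (g i)\<^sup>2)"
  proof (intro sum.mono_neutral_right ballI)
    fix i assume "i \<in> {..<d} - fst ` set L"
    then show "(g i)\<^sup>2 = 0"
      using map_of_eq_None_iff[of L i] by (simp add: g_def)
  qed (use L(2) in auto)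
  also have "\<dots> = (\<Sum>i\<in>fst ` set L. \<rho>\<^sup>2)"
  proof (intro sum.cong refl)
    fix i assume "i \<in> fst ` set L"
    then obtain e where "e \<in> set L" "i = fst e" by auto
    then have "\<bar>g i\<bar> = \<bar>\<rho>\<bar>"
      using g L(3) by (simp add: abs_mult)
    then show "(g i)\<^sup>2 = \<rho>\<^sup>2"
      by (simp only: abs_eq_iff power2_eq_iff)
  qed
  also have "\<dots> = real (card (fst ` set L)) * \<rho>\<^sup>2"
    by simp
  also have "card (fst ` set L) = length L"
    using distinct_card[OF L(1)] by simp
  finally have "norm (fvec d g) = \<rho> * sqrt (real (length L))"
    using assms(2) by (simp add: norm_Rd[OF fvec_in_Rd] real_sqrt_mult)
  moreover have "snd e * coord (fvec d g) (fst e) = - \<rho>" if "e \<in> set L" for e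
  proof -
    have "snd e * snd e = 1"
      using L(3)[OF that] abs_mult_self_eq[of "snd e"] by simp
    then show ?thesis
      using g[OF that] L(2) that by (auto simp: coord_fvec)
  qed
  ultimately show ?thesis
    using fvec_in_Rd[of d g] by (intro bexI[of _ "fvec d g"]) auto
qed

text \<open>
  Solves the equation that balances the two terms of the gap for the scale \<open>\<beta>\<close>; the exponents of the
  rate come from here.
\<close>

lemma rate_identity:
  fixes s q h T \<kappa> \<mu> :: real
  assumes pos: "0 < \<kappa>" "0 < \<mu>" "0 < h" "0 < T" and s: "1 < s" "s < q"
  defines "\<beta> \<equiv> (\<kappa> * h * T powr (1 - 3 * q / 2)) powr (1 / (q - s))"
  defines "D \<equiv> \<mu> * T powr (3 * q / 2) * \<beta> powr q"
  defines "E \<equiv> 2 * (q - s) / (q * (3 * s - 2))"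
  shows "\<mu> powr E * \<kappa> powr (2 / (3 * s - 2)) * h powr (2 / (3 * s - 2)) * (1 / D) powr E = T"
proof -
  have \<beta>: "0 < \<beta>" using pos by (simp add: \<beta>_def)
  have D: "0 < D" using pos \<beta> by (simp add: D_def)
  define \<alpha> where "\<alpha> = 2 / (3 * s - 2)"
  have E: "E = \<alpha> * (q - s) / q"
    by (simp add: E_def \<alpha>_def)
  have \<alpha>: "\<alpha> * (3 * s - 2) = 2"
    using s nonzero_divide_eq_eq[of "3 * s - 2" 2 \<alpha>] by (simp only: \<alpha>_def) auto
  \<comment> \<open>In logarithms the claim is linear. The coefficients of \<open>ln T\<close>
    combine to \<open>- \<alpha> * (3 * s - 2) / 2\<close>, which is -1.\<close>
  have ln\<beta>: "ln \<beta> = (ln \<kappa> + ln h + (1 - 3 * q / 2) * ln T) / (q - s)"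
    unfolding \<beta>_def using pos by (simp add: ln_powr ln_mult)
  have lnD: "ln D = ln \<mu> + 3 * q / 2 * ln T + q * ln \<beta>"
    unfolding D_def using pos \<beta> by (simp add: ln_powr ln_mult)
  have "E * (q * ln \<beta>) = \<alpha> * (ln \<kappa> + ln h + (1 - 3 * q / 2) * ln T)"
    unfolding ln\<beta> E using s by simp
  moreover have "E * (3 * q / 2 * ln T) = \<alpha> * ((q - s) * 3 / 2) * ln T"
    unfolding E using s by simp
  moreover have "\<alpha> * ((q - s) * 3 / 2) * ln T + \<alpha> * ((1 - 3 * q / 2) * ln T) = - (\<alpha> * (3 * s - 2)) / 2 * ln T"
    by (simp add: field_simps)
  moreover have "E * ln D = E * ln \<mu> + E * (3 * q / 2 * ln T) + E * (q * ln \<beta>)"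
    by (simp only: lnD distrib_left)
  ultimately have "E * ln D = E * ln \<mu> + \<alpha> * ln \<kappa> + \<alpha> * ln h - ln T"
    unfolding \<alpha> distrib_left by linarith
  then have "ln (\<mu> powr E * \<kappa> powr \<alpha> * h powr \<alpha> * (1 / D) powr E) = ln T"
    using pos D by (simp add: ln_powr ln_mult ln_div)
  then show ?thesis
    using pos D unfolding \<alpha>_def by (subst (asm) ln_inj_iff) auto
qed

section \<open>The lower bound\<close>

text \<open>At the last query the final link is nonnegative, so by \<open>chain_ge_last\<close> the
  chain is at least \<open>- N * real T\<close>. At the opposite point \<open>chain_le\<close> gives
  at most \<open>- 2 * N * real T\<close>. The gap is the difference, scaled by \<open>a\<close>,
  minus the power of the norm paid at the opposite point.\<close>

lemma hard_function:
  fixes a b \<sigma> :: real and m :: nat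
  assumes a: "0 < a" and b: "0 < b" and \<sigma>: "0 < \<sigma>" and q: "2 \<le> q" and T: "1 \<le> T" "T \<le> d"
    and A: "is_algorithm d T A"
  defines "F \<equiv> \<lambda>L x. a * chain (Suc (Suc m)) 0 L (b *\<^sub>R x) + \<sigma> / real q * norm x ^ q"
    and "N \<equiv> real (m + 3)"
  shows "\<exists>L xs. (\<forall>e\<in>set L. \<bar>snd e\<bar> \<le> 1) \<and> convex_on (Rd d) (\<lambda>x. a * chain (Suc (Suc m)) 0 L (b *\<^sub>R x)) \<and>
    uniformly_convex d q (\<sigma> / 2 ^ (q - 2)) (F L) \<and>
    (\<forall>x. is_arg_min (F L) (\<lambda>z. z \<in> Rd d) x \<longleftrightarrow> x = xs) \<and>
    a * N * real T - \<sigma> / real q * (2 * N * real T * sqrt (real T) / b) ^ q \<le> F L (iterate d p A (F L) T) - F L xs"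
proof -
  \<comment> \<open>The power of the norm is common to all candidate functions, so it plays the part
    of \<open>g\<close> in \<open>local_info_chain_prefix\<close>.\<close>
  obtain L where L: "length L = T" "admissible d L"
    and last: "0 \<le> snd (last L) * coord (iterate d p A (F L) T) (fst (last L))"
    using resisting_chain[OF A T(2), of p F T] local_info_chain_prefix[OF b, of _ d _ _ _ F a "Suc m"] T(1)
    unfolding F_def by fastforce
  have "L \<noteq> []"
    using L(1) T(1) by auto
  have sgn: "\<bar>snd e\<bar> = 1" if "e \<in> set L" for e
    using L(2) that by (simp add: admissible_def)
  let ?c = "chain (Suc (Suc m)) 0 L"
  let ?f = "\<lambda>x. a * ?c (b *\<^sub>R x)"
  have conv: "convex_on (Rd d) ?f"
  proof (rule convex_onI[OF _ convex_Rd])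
    fix t x y assume t: "0 < t" "t < (1 :: real)" and x: "x \<in> Rd d" and y: "y \<in> Rd d"
    have "b *\<^sub>R ((1 - t) *\<^sub>R x + t *\<^sub>R y) = (1 - t) *\<^sub>R (b *\<^sub>R x) + t *\<^sub>R (b *\<^sub>R y)"
      by (rule fseq_eqI) (simp add: algebra_simps)
    then have "?c (b *\<^sub>R ((1 - t) *\<^sub>R x + t *\<^sub>R y)) \<le> (1 - t) * ?c (b *\<^sub>R x) + t * ?c (b *\<^sub>R y)"
      using convex_onD[OF convex_on_chain, of t "b *\<^sub>R x" d "b *\<^sub>R y" m 0 L] t x y by (simp add: Rd_scale)
    then have "?f ((1 - t) *\<^sub>R x + t *\<^sub>R y) \<le> a * ((1 - t) * ?c (b *\<^sub>R x) + t * ?c (b *\<^sub>R y))"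
      using a by (intro mult_left_mono) auto
    then show "?f ((1 - t) *\<^sub>R x + t *\<^sub>R y) \<le> (1 - t) * ?f x + t * ?f y"
      by (simp add: distrib_left mult.left_commute)
  qed
  have "times_differentiable d (Suc 0) (\<lambda>x. ?c (b *\<^sub>R x))"
    by (intro times_differentiable_scale times_differentiable_chain) simp
  then have diff: "?f differentiable_on Rd d"
    by (intro differentiable_on_mult differentiable_on_const) (rule times_differentiable_SucD)
  have uc: "uniformly_convex d q (\<sigma> / 2 ^ (q - 2)) (F L)"
    unfolding F_def by (rule uniformly_convex_add_norm_power[OF conv diff \<sigma> q])
  have cont: "continuous_on (Rd d) (F L)"
    using uc times_differentiable_SucD(1)[of d 0 "F L"]
    by (auto simp: uniformly_convex_def intro: differentiable_imp_continuous_on)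
  obtain e L' where eL: "L = e # L'"
    using \<open>L \<noteq> []\<close> by (cases L) auto
  \<comment> \<open>The first link alone is a linear minorant of the chain, and the power of the
    norm outgrows it; this makes \<open>F L\<close> coercive.\<close>
  have lower: "\<sigma> / real q * norm x ^ q - a * b * norm x \<le> F L x" for x
  proof -
    have "- (b * norm x) \<le> affine_form 0 e (b *\<^sub>R x)"
    proof -
      have "\<bar>snd e * (b * coord x (fst e))\<bar> \<le> b * norm x"
        using sgn[of e] eL b abs_coord_le_norm[of x "fst e"] by (simp add: abs_mult)
      then show ?thesis
        by (simp add: affine_form_def abs_le_iff)
    qed
    also have "\<dots> \<le> ?c (b *\<^sub>R x)"
      unfolding eL by (rule chain_ge_hd)
    finally have "a * - (b * norm x) \<le> ?f x"
      using a by (intro mult_left_mono) auto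
    then show ?thesis
      by (simp add: F_def)
  qed
  obtain r where r: "\<And>t. r < t \<Longrightarrow> F L 0 < \<sigma> / real q * t ^ q - a * b * t"
    using power_dominates_linear[of "\<sigma> / real q" q "a * b" "F L 0"] \<sigma> q a b by auto
  obtain xs where xs: "xs \<in> Rd d" "\<And>x. x \<in> Rd d \<Longrightarrow> F L xs \<le> F L x"
    using minimizer_exists[OF cont, of r] r lower by (meson less_le_trans)
  have uniq: "x = xs" if "x \<in> Rd d" "\<And>z. z \<in> Rd d \<Longrightarrow> F L x \<le> F L z" for x
    by (rule uniformly_convex_unique_min[OF uc _ _ that xs]) (use \<sigma> q in auto)
  have arg_min: "is_arg_min (F L) (\<lambda>z. z \<in> Rd d) x \<longleftrightarrow> x = xs" for x
    unfolding is_arg_min_linorder using xs uniq by blast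
  have N: "0 < N" by (simp add: N_def)
  \<comment> \<open>Twice the depth \<open>N * real T\<close> that the chain can reach at the last
    query, so that \<open>N * real T\<close> remains as a gap.\<close>
  define \<rho> where "\<rho> = 2 * N * real T"
  have \<rho>: "0 \<le> \<rho>" using N by (simp add: \<rho>_def)
  obtain z where z: "z \<in> Rd d" "norm z \<le> \<rho> / b * sqrt (real T)" "\<And>e. e \<in> set L \<Longrightarrow> snd e * coord z (fst e) = - (\<rho> / b)"
    using exists_opposite_point[OF L(2), of "\<rho> / b"] \<rho> b L(1) by auto
  have "snd e * coord (b *\<^sub>R z) (fst e) = - \<rho>" if "e \<in> set L" for e
  proof -
    have "snd e * coord (b *\<^sub>R z) (fst e) = b * (snd e * coord z (fst e))"
      by simp
    then show ?thesis
      using z(3)[OF that] b by simp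
  qed
  then have "?c (b *\<^sub>R z) \<le> - \<rho> - real 0"
    using \<open>L \<noteq> []\<close> by (intro chain_le) auto
  then have "?f z \<le> a * (- \<rho>)"
    using a by (intro mult_left_mono) auto
  moreover have "\<sigma> / real q * norm z ^ q \<le> \<sigma> / real q * (\<rho> * sqrt (real T) / b) ^ q"
    using z(2) \<sigma> by (intro mult_left_mono power_mono) auto
  ultimately have up: "F L xs \<le> a * (- \<rho>) + \<sigma> / real q * (\<rho> * sqrt (real T) / b) ^ q"
    using xs(2)[OF z(1)] unfolding F_def by linarith
  let ?x = "iterate d p A (F L) T"
  have "0 \<le> b * (snd (last L) * coord ?x (fst (last L)))"
    using last b by simp
  then have "- (N * real T) \<le> snd (last L) * coord (b *\<^sub>R ?x) (fst (last L)) - real 0 - real (Suc (Suc (Suc m))) * (real (length L) - 1)"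
    using L(1) by (simp add: N_def algebra_simps)
  also have "\<dots> \<le> ?c (b *\<^sub>R ?x)"
    by (rule chain_ge_last[OF \<open>L \<noteq> []\<close>])
  finally have "a * (- (N * real T)) \<le> ?f ?x"
    using a by (intro mult_left_mono) auto
  moreover have "0 \<le> \<sigma> / real q * norm ?x ^ q"
    using \<sigma> by simp
  ultimately have "a * (- (N * real T)) \<le> F L ?x"
    unfolding F_def by linarith
  then have "a * N * real T - \<sigma> / real q * (\<rho> * sqrt (real T) / b) ^ q \<le> F L ?x - F L xs"
    using up by (simp add: \<rho>_def)
  then show ?thesis
    using conv uc arg_min sgn unfolding \<rho>_def by (intro exI[of _ L] exI[of _ xs]) auto
qed

theorem theorem1:
  fixes p q :: nat and \<nu> :: real
  assumes "1 \<le> p" and "2 \<le> q" and "0 < \<nu>" and "\<nu> \<le> 1" and "real p + \<nu> < real q"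
  shows "\<exists>c::real. c > 0 \<and>
    (\<forall>(H::real) (\<sigma>::real) (d::nat) (T::nat).
      H > 0 \<and> \<sigma> > 0 \<and> 1 \<le> d \<and> 1 \<le> T \<and> sqrt (real d) - 1 \<le> real T \<and> T \<le> d \<longrightarrow>
      (\<forall>A. is_algorithm d T A \<longrightarrow>
        (\<exists>f F. convex_on (Rd d) f \<and> holder_smooth d p \<nu> H f \<and>
          F = (\<lambda>x. f x + \<sigma> / real q * norm x ^ q) \<and>
          uniformly_convex d q (\<sigma> / 2 ^ (q - 2)) F \<and>
          (\<exists>xs. (\<forall>x. is_arg_min F (\<lambda>z. z \<in> Rd d) x \<longleftrightarrow> x = xs) \<and>
            (\<forall>\<epsilon>>0. F (iterate d p A F T) - F xs \<le> \<epsilon> \<longrightarrow>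
              real T \<ge> c * (H / \<sigma>) powr (2 / (3 * (real p + \<nu>) - 2))
                * (\<sigma> / \<epsilon>) powr (2 * (real q - real p - \<nu>)
                    / (real q * (3 * (real p + \<nu>) - 2))))))))"
proof -
  define s where "s = real p + \<nu>"
  have s: "1 < s" "s < real q"
    using assms by (auto simp: s_def)
  obtain B0 where "0 \<le> B0" and B0: "\<And>d L. \<forall>e\<in>set L. \<bar>snd e\<bar> \<le> 1 \<Longrightarrow>
      pos_deriv_bound d (Suc p) B0 (chain (Suc (Suc p)) 0 L)"
    using chain_deriv_bound[of "Suc p"] by (metis le_SucI order_refl)
  \<comment> \<open>Raised by 1 to be positive, since it occurs in denominators. It is fixed before
    \<open>H\<close>, \<sigma>, \<open>d\<close> and \<open>T\<close>, and therefore so is the final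
    constant.\<close>
  define B where "B = B0 + 1"
  have B: "0 < B" "B0 \<le> B"
    using \<open>0 \<le> B0\<close> by (auto simp: B_def)
  define N where "N = real (p + 3)"
  \<comment> \<open>Chosen so that \<open>\<mu> * \<kappa> = N / (4 * B)\<close>, which makes the
    norm term below exactly half of the gain.\<close>
  define \<kappa> where "\<kappa> = N * real q / (4 * B * (2 * N) ^ q)"
  define \<mu> where "\<mu> = (2 * N) ^ q / real q"
  define \<alpha> where "\<alpha> = 2 / (3 * s - 2)"
  define E where "E = 2 * (real q - s) / (real q * (3 * s - 2))"
  have N: "0 < N" by (simp add: N_def)
  have pos: "0 < \<kappa>" "0 < \<mu>"
    using N B assms(2) by (auto simp: \<kappa>_def \<mu>_def)
  have \<mu>\<kappa>: "\<mu> * \<kappa> = N / (4 * B)"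
    using N assms(2) by (simp add: \<mu>_def \<kappa>_def)
  have E: "0 < E"
    using s by (simp add: E_def)
  have "\<exists>f F. convex_on (Rd d) f \<and> holder_smooth d p \<nu> H f \<and>
      F = (\<lambda>x. f x + \<sigma> / real q * norm x ^ q) \<and>
      uniformly_convex d q (\<sigma> / 2 ^ (q - 2)) F \<and>
      (\<exists>xs. (\<forall>x. is_arg_min F (\<lambda>z. z \<in> Rd d) x \<longleftrightarrow> x = xs) \<and>
        (\<forall>\<epsilon>>0. F (iterate d p A F T) - F xs \<le> \<epsilon> \<longrightarrow>
          \<mu> powr E * \<kappa> powr \<alpha> * (H / \<sigma>) powr \<alpha> * (\<sigma> / \<epsilon>) powr E \<le> real T))"
    if H: "0 < H" and \<sigma>: "0 < \<sigma>" and T: "1 \<le> T" "T \<le> d" and A: "is_algorithm d T A"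
    for H \<sigma> :: real and d T A
  proof -
    \<comment> \<open>The reciprocal of the scale \<open>b\<close>. It solves the equation that
      \<open>\<sigma> * D\<close>, the norm term at the opposite point, is half of
      \<open>a * N * real T\<close>.\<close>
    define \<beta> where "\<beta> = (\<kappa> * (H / \<sigma>) * real T powr (1 - 3 * real q / 2)) powr (1 / (real q - s))"
    define D where "D = \<mu> * real T powr (3 * real q / 2) * \<beta> powr real q"
    \<comment> \<open>Makes the modulus \<open>2 * a * B * (1 / \<beta>) powr s\<close> from
      \<open>holder_smooth_scale\<close> equal to \<open>H\<close>.\<close>
    define a where "a = H * \<beta> powr s / (2 * B)"
    have T0: "0 < real T" using T by simp
    have \<beta>: "0 < \<beta>"
      using pos H \<sigma> T0 by (simp add: \<beta>_def)
    have D: "0 < D"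
      using pos T0 \<beta> by (simp add: D_def)
    have a: "0 < a"
      using H \<beta> B by (simp add: a_def)
    have \<beta>qs: "\<beta> powr (real q - s) = \<kappa> * (H / \<sigma>) * real T powr (1 - 3 * real q / 2)"
      using s pos H \<sigma> T0 by (simp add: \<beta>_def powr_powr)
    have "real T * sqrt (real T) = real T powr (3 / 2)"
    proof -
      have "real T powr 1 * real T powr (1 / 2) = real T powr (3 / 2)"
        by (simp only: powr_add[symmetric]) simp
      then show ?thesis
        using T0 by (simp add: powr_half_sqrt)
    qed
    then have "(2 * N * real T * sqrt (real T) / (1 / \<beta>)) ^ q = (2 * N) ^ q * (real T powr (3 / 2)) ^ q * \<beta> ^ q"
      by (simp add: power_mult_distrib mult.assoc)
    also have "\<dots> = (2 * N) ^ q * real T powr (3 * real q / 2) * \<beta> powr real q"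
      using T0 \<beta> by (simp add: powr_realpow[symmetric] powr_powr)
    finally have norm_term: "\<sigma> / real q * (2 * N * real T * sqrt (real T) / (1 / \<beta>)) ^ q = \<sigma> * D"
      by (simp add: D_def \<mu>_def)
    have "\<sigma> * D = \<sigma> * \<mu> * real T powr (3 * real q / 2) * (\<beta> powr s * \<beta> powr (real q - s))"
      using \<beta> by (simp add: D_def powr_add[symmetric])
    also have "\<dots> = (\<mu> * \<kappa>) * H * \<beta> powr s * (real T powr (3 * real q / 2) * real T powr (1 - 3 * real q / 2))"
      unfolding \<beta>qs using \<sigma> by simp
    also have "\<dots> = a * N * real T / 2"
      unfolding \<mu>\<kappa> powr_add[symmetric] using T0 by (simp add: a_def)
    \<comment> \<open>Hence the gap of \<open>hard_function\<close> is at least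
      \<open>\<sigma> * D\<close>, and an accuracy \<epsilon> forces
      \<open>\<sigma> * D \<le> \<epsilon>\<close>.\<close>
    finally have balance: "a * N * real T = 2 * (\<sigma> * D)"
      by simp
    define F where "F = (\<lambda>L x. a * chain (Suc (Suc p)) 0 L ((1 / \<beta>) *\<^sub>R x) + \<sigma> / real q * norm x ^ q)"
    obtain L xs where L: "\<forall>e\<in>set L. \<bar>snd e\<bar> \<le> 1"
      and conv: "convex_on (Rd d) (\<lambda>x. a * chain (Suc (Suc p)) 0 L ((1 / \<beta>) *\<^sub>R x))"
      and uc: "uniformly_convex d q (\<sigma> / 2 ^ (q - 2)) (F L)"
      and xs: "\<forall>x. is_arg_min (F L) (\<lambda>z. z \<in> Rd d) x \<longleftrightarrow> x = xs"
      and gap: "a * N * real T - \<sigma> / real q * (2 * N * real T * sqrt (real T) / (1 / \<beta>)) ^ q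
        \<le> F L (iterate d p A (F L) T) - F L xs"
      using hard_function[OF a _ \<sigma> assms(2) T A, of "1 / \<beta>" p p] \<beta> unfolding F_def N_def by auto
    have "pos_deriv_bound d (Suc p) B (chain (Suc (Suc p)) 0 L)"
      using pos_deriv_bound_weaken[OF B0[OF L] B(2)] .
    then have "holder_smooth d p \<nu> (2 * a * B * (1 / \<beta>) powr (real p + \<nu>))
        (\<lambda>x. a * chain (Suc (Suc p)) 0 L ((1 / \<beta>) *\<^sub>R x))"
      using a B \<beta> assms by (intro holder_smooth_scale times_differentiable_chain) auto
    moreover have "2 * a * B * (1 / \<beta>) powr (real p + \<nu>) = H"
      unfolding s_def[symmetric] using \<beta> B by (simp add: a_def powr_divide)
    ultimately have hs: "holder_smooth d p \<nu> H (\<lambda>x. a * chain (Suc (Suc p)) 0 L ((1 / \<beta>) *\<^sub>R x))"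
      by simp
    have "\<mu> powr E * \<kappa> powr \<alpha> * (H / \<sigma>) powr \<alpha> * (\<sigma> / \<epsilon>) powr E \<le> real T"
      if "0 < \<epsilon>" "F L (iterate d p A (F L) T) - F L xs \<le> \<epsilon>" for \<epsilon>
    proof -
      have "\<sigma> * D \<le> \<epsilon>"
        using gap that unfolding norm_term balance by linarith
      then have "\<sigma> / \<epsilon> \<le> 1 / D"
        using D \<open>0 < \<epsilon>\<close> by (simp add: field_simps)
      then have "(\<sigma> / \<epsilon>) powr E \<le> (1 / D) powr E"
        using \<sigma> \<open>0 < \<epsilon>\<close> E by (intro powr_mono2) auto
      then have "\<mu> powr E * \<kappa> powr \<alpha> * (H / \<sigma>) powr \<alpha> * (\<sigma> / \<epsilon>) powr E \<le>
          \<mu> powr E * \<kappa> powr \<alpha> * (H / \<sigma>) powr \<alpha> * (1 / D) powr E"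
        by (intro mult_left_mono) auto
      also have "\<dots> = real T"
        unfolding \<alpha>_def E_def D_def \<beta>_def using pos H \<sigma> T0 s by (intro rate_identity) auto
      finally show ?thesis .
    qed
    then show ?thesis
      using conv hs uc xs unfolding F_def by blast
  qed
  moreover have "\<alpha> = 2 / (3 * (real p + \<nu>) - 2)"
    "E = 2 * (real q - real p - \<nu>) / (real q * (3 * (real p + \<nu>) - 2))"
    by (simp_all add: \<alpha>_def E_def s_def algebra_simps)
  ultimately show ?thesis
    using pos by (intro exI[of _ "\<mu> powr E * \<kappa> powr \<alpha>"] conjI) (simp, blast)
qed

end
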